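(* Let $P=((V,E),\langle V_1,V_R\rangle,\delta)$ be a Markov decision process with $n=|V|$ vertices, accessed only through set-based symbolic operations. For every $0<\epsilon\le 0.5$, the MEC decomposition of $P$ can be computed by a (deterministic) set-based symbolic algorithm using $O(n^{2-\epsilon}\log n)$ symbolic operations and symbolic space $O(n^{\epsilon}\log n)$.
   Context: A Markov decision process (MDP) $P=((V,E),\langle V_1,V_R\rangle,\delta)$ consists of a finite vertex set $V$ partitioned into player-1 vertices $V_1$ and random vertices $V_R$, an edge set $E\subseteq V\times V$, and a function $\delta$ assigning to each $v\in V_R$ a probability distribution over $V$ with $(v,w)\in E$ iff $\delta(v)[w]>0$ (w.l.o.g. uniform over the successors). It is assumed that there are no self-loops and every vertex has an outgoing edge. An end-component (EC) is a set $X\subseteq V$ such that the subgraph $(X,E\cap(X\times X))$ is strongly connected and for every $v\in X\cap V_R$ and every $(v,u)\in E$ we have $u\in X$; it is trivial if it is a single vertex with no edges, non-trivial otherwise. A maximal end-component (MEC) is an EC maximal under inclusion. The MEC decomposition is the partition of $V$ into the MECs and the set of vertices belonging to no MEC. In the set-based symbolic model, the algorithm may use ordinary RAM computation but accesses the MDP only via: basic set operations ($\cup,\cap,\subseteq,\setminus,\times,=$) on sets of vertices or edges; one-step operations $\mathrm{Pre}_E(S)=\{v\in V\mid \exists w\in S,(v,w)\in E\}$ and $\mathrm{Post}_E(S)=\{v\in V\mid \exists w\in S,(w,v)\in E\}$ (for any stored edge set); picking an arbitrary element of a set; and computing the cardinality of a set. The number of symbolic operations is the number of such operations performed; the symbolic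 space is the maximum number of sets (regardless of their size) stored simultaneously. *)

theory Defs
  imports "HOL-Probability.Probability_Mass_Function" "HOL-Library.Landau_Symbols"
begin

section \<open>Markov decision processes and end-components\<close>

record 'v mdp =
  vertices :: "'v set"
  edges :: "('v \<times> 'v) set"
  player1 :: "'v set"
  random :: "'v set"
  trans_prob :: "'v \<Rightarrow> 'v pmf"

definition is_mdp :: "'v mdp \<Rightarrow> bool" where
  "is_mdp P \<longleftrightarrow>
     finite (vertices P) \<and>
     edges P \<subseteq> vertices P \<times> vertices P \<and>
     player1 P \<union> random P = vertices P \<and>
     player1 P \<inter> random P = {} \<and>
     (\<forall>v \<in> random P. \<forall>w. (v, w) \<in> edges P \<longleftrightarrow> pmf (trans_prob P v) w > 0) \<and>
     (\<forall>v. (v, v) \<notin> edges P) \<and>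
     (\<forall>v \<in> vertices P. \<exists>w. (v, w) \<in> edges P)"

definition strongly_connected_on :: "('v \<times> 'v) set \<Rightarrow> 'v set \<Rightarrow> bool" where
  "strongly_connected_on F X \<longleftrightarrow>
     X \<noteq> {} \<and> (\<forall>u \<in> X. \<forall>v \<in> X. (u, v) \<in> (F \<inter> X \<times> X)\<^sup>*)"

definition end_component :: "'v mdp \<Rightarrow> 'v set \<Rightarrow> bool" where
  "end_component P X \<longleftrightarrow>
     X \<subseteq> vertices P \<and>
     strongly_connected_on (edges P) X \<and>
     (\<forall>v \<in> X \<inter> random P. \<forall>u. (v, u) \<in> edges P \<longrightarrow> u \<in> X)"

text \<open>Trivial end-components are included: a player-1 vertex that lies in no larger
  end-component is a maximal end-component on its own.\<close>

definition max_end_component :: "'v mdp \<Rightarrow> 'v set \<Rightarrow> bool" where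
  "max_end_component P X \<longleftrightarrow>
     end_component P X \<and> (\<forall>Y. end_component P Y \<and> X \<subseteq> Y \<longrightarrow> Y = X)"

text \<open>The blocks of the partition are labelled, so that the block of vertices in no
  maximal end-component can be told apart from the maximal end-components. It is left out
  when it is empty, as blocks of a partition are non-empty.\<close>

datatype block_label = MEC_Block | Rest_Block

definition rest_vertices :: "'v mdp \<Rightarrow> 'v set" where
  "rest_vertices P = vertices P - \<Union>{X. max_end_component P X}"

definition mec_decomposition :: "'v mdp \<Rightarrow> (block_label \<times> 'v set) set" where
  "mec_decomposition P =
     {(MEC_Block, X) | X. max_end_component P X} \<union>
     {(Rest_Block, R) | R. R = rest_vertices P \<and> R \<noteq> {}}"


section \<open>Set-based symbolic programs\<close>

text \<open>A program is a while program over two stores: an ordinary memory of natural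
  numbers, and a store of symbolic sets. Cells of both stores are addressed by arithmetic
  expressions, so indirect addressing (hence arrays and stacks) is available in both.
  A program never sees a vertex or an edge: only truth values and cardinalities pass from
  the symbolic store to the memory.\<close>

datatype aexp =
    Const nat
  | Load aexp
  | Add aexp aexp
  | Sub aexp aexp
  | Mul aexp aexp
  | Div aexp aexp
  | Less aexp aexp
  | Eq aexp aexp

fun aval :: "aexp \<Rightarrow> (nat \<Rightarrow> nat) \<Rightarrow> nat" where
  "aval (Const k) m = k"
| "aval (Load a) m = m (aval a m)"
| "aval (Add a b) m = aval a m + aval b m"
| "aval (Sub a b) m = aval a m - aval b m"
| "aval (Mul a b) m = aval a m * aval b m"
| "aval (Div a b) m = aval a m div aval b m"
| "aval (Less a b) m = of_bool (aval a m < aval b m)"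
| "aval (Eq a b) m = of_bool (aval a m = aval b m)"

datatype 'v symset = VSet "'v set" | ESet "('v \<times> 'v) set"

datatype setop = Cup | Cap | Setminus | Cross | Pre | Post

datatype testop = Subset | Equal

text \<open>For \<open>Pre\<close> and \<open>Post\<close> the first argument is the edge set. Stored edge sets only ever
  contain pairs of vertices of the input, so no intersection with its vertex set is
  needed. Ill-typed applications are undefined.\<close>

fun setop_result :: "setop \<Rightarrow> 'v symset \<Rightarrow> 'v symset \<Rightarrow> 'v symset option" where
  "setop_result Cup (VSet A) (VSet B) = Some (VSet (A \<union> B))"
| "setop_result Cup (ESet A) (ESet B) = Some (ESet (A \<union> B))"
| "setop_result Cap (VSet A) (VSet B) = Some (VSet (A \<inter> B))"
| "setop_result Cap (ESet A) (ESet B) = Some (ESet (A \<inter> B))"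
| "setop_result Setminus (VSet A) (VSet B) = Some (VSet (A - B))"
| "setop_result Setminus (ESet A) (ESet B) = Some (ESet (A - B))"
| "setop_result Cross (VSet A) (VSet B) = Some (ESet (A \<times> B))"
| "setop_result Pre (ESet F) (VSet S) = Some (VSet {v. \<exists>w \<in> S. (v, w) \<in> F})"
| "setop_result Post (ESet F) (VSet S) = Some (VSet {v. \<exists>w \<in> S. (w, v) \<in> F})"
| "setop_result _ _ _ = None"

fun testop_result :: "testop \<Rightarrow> 'v symset \<Rightarrow> 'v symset \<Rightarrow> bool option" where
  "testop_result Subset (VSet A) (VSet B) = Some (A \<subseteq> B)"
| "testop_result Subset (ESet A) (ESet B) = Some (A \<subseteq> B)"
| "testop_result Equal (VSet A) (VSet B) = Some (A = B)"
| "testop_result Equal (ESet A) (ESet B) = Some (A = B)"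
| "testop_result _ _ _ = None"

fun symset_card :: "'v symset \<Rightarrow> nat" where
  "symset_card (VSet A) = card A"
| "symset_card (ESet A) = card A"

text \<open>A picked element is stored as a singleton, and therefore occupies symbolic space.\<close>

fun symset_picks :: "'v symset \<Rightarrow> 'v symset set" where
  "symset_picks (VSet A) = {VSet {v} | v. v \<in> A}"
| "symset_picks (ESet A) = {ESet {e} | e. e \<in> A}"

text \<open>The outcome of picks is beyond the control of the program. It is resolved by an
  adversary, whose answer to a pick may depend on the number of operations performed so
  far: two picks from the same set need not agree.\<close>

type_synonym 'v picker = "nat \<Rightarrow> 'v symset \<Rightarrow> 'v symset"

definition valid_picker :: "'v picker \<Rightarrow> bool" where
  "valid_picker pk \<longleftrightarrow> (\<forall>k x. symset_picks x \<noteq> {} \<longrightarrow> pk k x \<in> symset_picks x)"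

datatype com =
    Skip
  | Store aexp aexp
  | SetOp aexp setop aexp aexp
  | Test aexp testop aexp aexp
  | Card aexp aexp
  | Pick aexp aexp
  | Discard aexp
  | Emit block_label aexp
  | Seq com com
  | If aexp com com
  | While aexp com

record 'v state =
  mem :: "nat \<Rightarrow> nat"
  store :: "nat \<rightharpoonup> 'v symset"
  num_ops :: nat
  peak_space :: nat
  reported :: "(block_label \<times> 'v set) list"

definition put_set :: "nat \<Rightarrow> 'v symset \<Rightarrow> 'v state \<Rightarrow> 'v state" where
  "put_set d x s = s\<lparr>
     store := (store s)(d \<mapsto> x),
     num_ops := num_ops s + 1,
     peak_space := max (peak_space s) (card (dom ((store s)(d \<mapsto> x))))\<rparr>"

definition put_answer :: "nat \<Rightarrow> nat \<Rightarrow> 'v state \<Rightarrow> 'v state" where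
  "put_answer a k s = s\<lparr>mem := (mem s)(a := k), num_ops := num_ops s + 1\<rparr>"

text \<open>\<open>exec pk c s t\<close>: under the picks of \<open>pk\<close>, the program \<open>c\<close> started in \<open>s\<close> terminates
  without error in \<open>t\<close>. Reading an unused cell of the symbolic store, an ill-typed
  operation and a pick from the empty set are errors. Reported blocks go to a write-only
  output; the computation on the memory, discarding a set and reporting a block are
  not symbolic operations.\<close>

inductive exec :: "'v picker \<Rightarrow> com \<Rightarrow> 'v state \<Rightarrow> 'v state \<Rightarrow> bool" for pk where
  Skip: "exec pk Skip s s"
| Store: "exec pk (Store a b) s (s\<lparr>mem := (mem s)(aval a (mem s) := aval b (mem s))\<rparr>)"
| SetOp: "\<lbrakk>store s (aval a (mem s)) = Some x; store s (aval b (mem s)) = Some y;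
      setop_result f x y = Some z\<rbrakk>
    \<Longrightarrow> exec pk (SetOp d f a b) s (put_set (aval d (mem s)) z s)"
| Test: "\<lbrakk>store s (aval a (mem s)) = Some x; store s (aval b (mem s)) = Some y;
      testop_result f x y = Some r\<rbrakk>
    \<Longrightarrow> exec pk (Test d f a b) s (put_answer (aval d (mem s)) (of_bool r) s)"
| Card: "store s (aval a (mem s)) = Some x
    \<Longrightarrow> exec pk (Card d a) s (put_answer (aval d (mem s)) (symset_card x) s)"
| Pick: "\<lbrakk>store s (aval a (mem s)) = Some x; symset_picks x \<noteq> {}\<rbrakk>
    \<Longrightarrow> exec pk (Pick d a) s (put_set (aval d (mem s)) (pk (num_ops s) x) s)"
| Discard: "exec pk (Discard a) s (s\<lparr>store := (store s)(aval a (mem s) := None)\<rparr>)"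
| Emit: "store s (aval a (mem s)) = Some (VSet X)
    \<Longrightarrow> exec pk (Emit l a) s (s\<lparr>reported := reported s @ [(l, X)]\<rparr>)"
| Seq: "\<lbrakk>exec pk c1 s1 s2; exec pk c2 s2 s3\<rbrakk> \<Longrightarrow> exec pk (Seq c1 c2) s1 s3"
| IfTrue: "\<lbrakk>aval b (mem s) \<noteq> 0; exec pk c1 s t\<rbrakk> \<Longrightarrow> exec pk (If b c1 c2) s t"
| IfFalse: "\<lbrakk>aval b (mem s) = 0; exec pk c2 s t\<rbrakk> \<Longrightarrow> exec pk (If b c1 c2) s t"
| WhileFalse: "aval b (mem s) = 0 \<Longrightarrow> exec pk (While b c) s s"
| WhileTrue: "\<lbrakk>aval b (mem s1) \<noteq> 0; exec pk c s1 s2; exec pk (While b c) s2 s3\<rbrakk>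
    \<Longrightarrow> exec pk (While b c) s1 s3"

text \<open>Programs are deterministic once the picks are fixed. Hence the existence of a
  terminating execution for every picker says that all executions terminate
  without error.\<close>

inductive_cases exec_cases:
  "exec pk Skip s t" "exec pk (Store a b) s t" "exec pk (SetOp d f a b) s t"
  "exec pk (Test d g a b) s t" "exec pk (Card d a) s t" "exec pk (Pick d a) s t"
  "exec pk (Discard a) s t" "exec pk (Emit l a) s t" "exec pk (Seq c1 c2) s t"
  "exec pk (If b c1 c2) s t" "exec pk (While b c) s t"

lemma exec_deterministic: "exec pk c s t \<Longrightarrow> exec pk c s u \<Longrightarrow> t = u"
proof (induction arbitrary: u rule: exec.induct)
  case (Seq c1 s1 s2 c2 s3)
  then show ?case by (metis exec_cases(9))
next
  case (IfTrue b s c1 t c2)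
  then show ?case by (metis exec_cases(10) not_gr_zero)
next
  case (IfFalse b s c2 t c1)
  then show ?case by (metis exec_cases(10) not_gr_zero)
next
  case (WhileFalse b s c)
  then show ?case by (metis exec_cases(11) not_gr_zero)
next
  case (WhileTrue b s1 c s2 s3)
  then show ?case by (metis exec_cases(11) not_gr_zero)
qed (fastforce elim: exec_cases(1-8))+

text \<open>The trade-off parameter, a real number, is made available to the program
  only through the number \<open>\<lceil>n\<^sup>\<epsilon>\<rceil>\<close> in cell 0 of the memory. The four input sets
  count as stored sets. The transition probabilities are not accessible.\<close>

definition init_state :: "real \<Rightarrow> 'v mdp \<Rightarrow> 'v state" where
  "init_state \<epsilon> P = \<lparr>
     mem = (\<lambda>_. 0)(0 := nat \<lceil>real (card (vertices P)) powr \<epsilon>\<rceil>),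
     store = [0 \<mapsto> VSet (vertices P), 1 \<mapsto> ESet (edges P),
              2 \<mapsto> VSet (player1 P), 3 \<mapsto> VSet (random P)],
     num_ops = 0,
     peak_space = 4,
     reported = []\<rparr>"

text \<open>\<open>T\<close> and \<open>S\<close> bound the number of symbolic operations and the symbolic space in terms
  of the number of vertices. Every block is reported exactly once.\<close>

definition computes_mec_decomposition ::
    "com \<Rightarrow> real \<Rightarrow> (nat \<Rightarrow> real) \<Rightarrow> (nat \<Rightarrow> real) \<Rightarrow> 'v mdp \<Rightarrow> bool" where
  "computes_mec_decomposition c \<epsilon> T S P \<longleftrightarrow>
     (\<forall>pk. valid_picker pk \<longrightarrow>
       (\<exists>t. exec pk c (init_state \<epsilon> P) t \<and>
            distinct (reported t) \<and>
            set (reported t) = mec_decomposition P \<and>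
            real (num_ops t) \<le> T (card (vertices P)) \<and>
            real (peak_space t) \<le> S (card (vertices P))))"

end

theory Submission
  imports Defs "HOL-Real_Asymp.Real_Asymp"
begin

text \<open>
  With \<open>n\<close> vertices, \<open>O(n\<^sup>3\<^sup>/\<^sup>2 log n)\<close> operations and constantly many stored sets suffice,
  whatever \<open>\<epsilon>\<close> is, because a partition of the vertices can be stored as one edge set, its
  equivalence relation.

  A separator \<open>T\<close> of \<open>O(\<surd>n log n)\<close> vertices is found by refining blocks of vertices.
  Random vertices with an edge out of their block are discarded. Otherwise a layered search,
  forwards and then backwards from one vertex of the block, either shows that the block is
  an end-component, or meets within \<open>O(\<surd>n log n)\<close> layers a (possibly empty) layer that is
  smaller by a factor \<open>\<surd>n\<close> than both parts of the block it separates; that layer goes to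
  \<open>T\<close>, and the block is split into the two parts. There are at most \<open>2n\<close> such steps.

  The vertices \<open>t\<close> of \<open>T\<close> are then put back one by one, with \<open>O(n)\<close> operations each. Let the
  maximal end-components inside \<open>U\<close> be known. Discarding random vertices with an edge out of
  \<open>U \<union> {t}\<close>, and known components without an outgoing edge, until nothing changes, leaves a
  set in which every vertex reaches \<open>t\<close>; what \<open>t\<close> reaches in it is the maximal
  end-component of \<open>t\<close> inside \<open>U \<union> {t}\<close>.
\<close>

section \<open>Running programs\<close>

text \<open>Total-correctness precondition. One final state suffices, since execution is
  deterministic once the picker is fixed.\<close>

definition runs :: "'v picker \<Rightarrow> com \<Rightarrow> 'v state \<Rightarrow> ('v state \<Rightarrow> bool) \<Rightarrow> bool" where
  "runs pk c s Q \<longleftrightarrow> (\<exists>t. exec pk c s t \<and> Q t)"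

inductive_simps exec_step_simps:
  "exec pk Skip s t" "exec pk (Store a b) s t" "exec pk (SetOp d f a b) s t"
  "exec pk (Test d g a b) s t" "exec pk (Card d a) s t" "exec pk (Emit l a) s t"
  "exec pk (Seq c1 c2) s t" "exec pk (If b c1 c2) s t"

text \<open>Rewriting with these equations executes straight-line code symbolically. Picks and loops
  get rules of their own, as they need a case for each element and an invariant.\<close>

lemma runs_simps [simp]:
  "runs pk Skip s Q \<longleftrightarrow> Q s"
  "runs pk (Store a b) s Q \<longleftrightarrow>
     Q (s\<lparr>mem := (mem s)(aval a (mem s) := aval b (mem s))\<rparr>)"
  "runs pk (SetOp d f a b) s Q \<longleftrightarrow>
     (\<exists>x. store s (aval a (mem s)) = Some x \<and> (\<exists>y. store s (aval b (mem s)) = Some y \<and>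
        (\<exists>z. setop_result f x y = Some z \<and> Q (put_set (aval d (mem s)) z s))))"
  "runs pk (Test d g a b) s Q \<longleftrightarrow>
     (\<exists>x. store s (aval a (mem s)) = Some x \<and> (\<exists>y. store s (aval b (mem s)) = Some y \<and>
        (\<exists>r. testop_result g x y = Some r \<and> Q (put_answer (aval d (mem s)) (of_bool r) s))))"
  "runs pk (Card d a) s Q \<longleftrightarrow>
     (\<exists>x. store s (aval a (mem s)) = Some x \<and> Q (put_answer (aval d (mem s)) (symset_card x) s))"
  "runs pk (Emit l a) s Q \<longleftrightarrow>
     (\<exists>X. store s (aval a (mem s)) = Some (VSet X) \<and>
        Q (s\<lparr>reported := reported s @ [(l, X)]\<rparr>))"
  "runs pk (Seq c1 c2) s Q \<longleftrightarrow> runs pk c1 s (\<lambda>t. runs pk c2 t Q)"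
  "runs pk (If b c1 c2) s Q \<longleftrightarrow> runs pk (if aval b (mem s) \<noteq> 0 then c1 else c2) s Q"
  unfolding runs_def exec_step_simps by (blast | simp)+

text \<open>The picker is adversarial, so the postcondition must be established for every element of
  the set.\<close>

lemma runs_Pick:
  assumes "valid_picker pk" "store s (aval a (mem s)) = Some (VSet A)" "A \<noteq> {}"
    and "\<And>v. v \<in> A \<Longrightarrow> Q (put_set (aval d (mem s)) (VSet {v}) s)"
  shows "runs pk (Pick d a) s Q"
proof -
  have ne: "symset_picks (VSet A) \<noteq> {}"
    using assms(3) by auto
  then have "pk (num_ops s) (VSet A) \<in> symset_picks (VSet A)"
    using assms(1) unfolding valid_picker_def by blast
  then obtain v where "v \<in> A" "pk (num_ops s) (VSet A) = VSet {v}"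
    by auto
  then show ?thesis
    using assms(4) exec.Pick[OF assms(2) ne, of pk d] unfolding runs_def by metis
qed

text \<open>The ghost value \<open>g\<close> carries the mathematical objects that the state only
  encodes, such as a family of blocks or a search layer. The measure \<open>f\<close> is taken on
  \<open>g\<close> rather than on the state.\<close>

lemma runs_While:
  fixes f :: "'g \<Rightarrow> nat"
  assumes "I g s"
    and step: "\<And>g s. I g s \<Longrightarrow> aval b (mem s) \<noteq> 0 \<Longrightarrow>
      runs pk c s (\<lambda>t. \<exists>g'. I g' t \<and> f g' < f g)"
    and final: "\<And>g s. I g s \<Longrightarrow> aval b (mem s) = 0 \<Longrightarrow> Q s"
  shows "runs pk (While b c) s Q"
  using assms(1)
proof (induction "f g" arbitrary: g s rule: less_induct)
  case less
  show ?case
  proof (cases "aval b (mem s) = 0")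
    case True
    then show ?thesis
      using final[OF less.prems] by (auto simp: runs_def intro: exec.WhileFalse)
  next
    case False
    then obtain t g' where "exec pk c s t" "I g' t" "f g' < f g"
      using step[OF less.prems] by (auto simp: runs_def)
    then show ?thesis
      using less.hyps[of g' t] False by (auto simp: runs_def intro: exec.WhileTrue)
  qed
qed

lemma put_set_simps [simp]:
  "mem (put_set d x s) = mem s"
  "store (put_set d x s) = (store s)(d \<mapsto> x)"
  "num_ops (put_set d x s) = num_ops s + 1"
  "reported (put_set d x s) = reported s"
  by (simp_all add: put_set_def)

lemma put_answer_simps [simp]:
  "mem (put_answer a k s) = (mem s)(a := k)"
  "store (put_answer a k s) = store s"
  "num_ops (put_answer a k s) = num_ops s + 1"
  "reported (put_answer a k s) = reported s"
  by (simp_all add: put_answer_def)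

section \<open>Symbolic space, bounded by the syntax of the program alone\<close>

fun writes_below :: "nat \<Rightarrow> com \<Rightarrow> bool" where
  "writes_below k (SetOp (Const d) f a b) \<longleftrightarrow> d < k"
| "writes_below k (SetOp d f a b) \<longleftrightarrow> False"
| "writes_below k (Pick (Const d) a) \<longleftrightarrow> d < k"
| "writes_below k (Pick d a) \<longleftrightarrow> False"
| "writes_below k (Seq c1 c2) \<longleftrightarrow> writes_below k c1 \<and> writes_below k c2"
| "writes_below k (If b c1 c2) \<longleftrightarrow> writes_below k c1 \<and> writes_below k c2"
| "writes_below k (While b c) \<longleftrightarrow> writes_below k c"
| "writes_below k _ \<longleftrightarrow> True"

lemma put_set_space:
  assumes "dom (store s) \<subseteq> {..<k}" "peak_space s \<le> k" "d < k"
  shows "dom (store (put_set d x s)) \<subseteq> {..<k}" "peak_space (put_set d x s) \<le> k"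
proof -
  show sub: "dom (store (put_set d x s)) \<subseteq> {..<k}"
    using assms by auto
  then have "card (dom (store (put_set d x s))) \<le> k"
    using card_mono[of "{..<k}"] by fastforce
  then show "peak_space (put_set d x s) \<le> k"
    using assms(2) by (simp add: put_set_def)
qed

text \<open>Sets are only written to constant addresses below \<open>k\<close>, so the occupied
  cells stay in \<open>{..<k}\<close>, and each newly recorded peak is the cardinality of a subset
  of it.\<close>

lemma exec_space:
  assumes "exec pk c s t" "writes_below k c" "dom (store s) \<subseteq> {..<k}" "peak_space s \<le> k"
  shows "dom (store t) \<subseteq> {..<k} \<and> peak_space t \<le> k"
  using assms
proof (induction rule: exec.induct)
  case (SetOp s a x b y f z d)
  then show ?case
    by (cases d) (auto simp del: put_set_simps dest: put_set_space)
next
  case (Pick s a x d)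
  then show ?case
    by (cases d) (auto simp del: put_set_simps dest: put_set_space)
qed (auto simp: put_answer_def split: if_splits)

abbreviation set_op :: "nat \<Rightarrow> setop \<Rightarrow> nat \<Rightarrow> nat \<Rightarrow> com" where
  "set_op d f a b \<equiv> SetOp (Const d) f (Const a) (Const b)"

abbreviation var :: "nat \<Rightarrow> aexp" where
  "var a \<equiv> Load (Const a)"

notation Seq (infixr ";;" 60)

section \<open>End-components inside a set of vertices\<close>

lemma strongly_connected_onI:
  assumes "v \<in> X" "\<And>u. u \<in> X \<Longrightarrow> (v, u) \<in> (F \<inter> X \<times> X)\<^sup>*"
    "\<And>u. u \<in> X \<Longrightarrow> (u, v) \<in> (F \<inter> X \<times> X)\<^sup>*"
  shows "strongly_connected_on F X"
  unfolding strongly_connected_on_def using assms by (meson empty_iff rtrancl_trans)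

lemma rtrancl_restrict_mono:
  "(u, v) \<in> (F \<inter> X \<times> X)\<^sup>* \<Longrightarrow> X \<subseteq> Y \<Longrightarrow> (u, v) \<in> (F \<inter> Y \<times> Y)\<^sup>*"
  by (erule rev_subsetD, rule rtrancl_mono) auto

lemma rtrancl_leaves:
  assumes "(x, y) \<in> r\<^sup>*" "x \<in> A" "y \<notin> A"
  obtains a b where "(a, b) \<in> r" "a \<in> A" "b \<notin> A"
  using assms by (induction rule: rtrancl_induct) auto

text \<open>Every vertex on a path from \<open>x\<close> is itself reachable from \<open>x\<close>,
  so the path stays in \<open>C\<close>.\<close>

lemma rtrancl_restrict_Image:
  assumes "(x, y) \<in> (F \<inter> S \<times> S)\<^sup>*"
  defines "C \<equiv> (F \<inter> S \<times> S)\<^sup>* `` {x}"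
  shows "(x, y) \<in> (F \<inter> C \<times> C)\<^sup>*"
  using assms(1)
proof (induction rule: rtrancl_induct)
  case (step y z)
  then have "(y, z) \<in> F \<inter> C \<times> C"
    using rtrancl.rtrancl_into_rtrancl[OF step(1,2)] by (auto simp: C_def)
  then show ?case
    using step.IH by (rule rtrancl.rtrancl_into_rtrancl[rotated])
qed simp

lemma rtrancl_restrict_Image_target:
  assumes "(x, t) \<in> (F \<inter> S \<times> S)\<^sup>*" "x \<in> C"
    and C: "C \<subseteq> S" "\<And>a b. a \<in> C \<Longrightarrow> (a, b) \<in> F \<Longrightarrow> b \<in> S \<Longrightarrow> b \<in> C"
  shows "(x, t) \<in> (F \<inter> C \<times> C)\<^sup>*"
proof -
  have "(x, t) \<in> (F \<inter> C \<times> C)\<^sup>* \<and> t \<in> C"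
    using assms(1)
  proof (induction rule: rtrancl_induct)
    case (step y z)
    then show ?case
      using C(2)[of y z] by (auto intro: rtrancl.rtrancl_into_rtrancl)
  qed (use assms(2) in simp)
  then show ?thesis by simp
qed

lemma end_component_not_empty: "end_component P X \<Longrightarrow> X \<noteq> {}"
  by (simp add: end_component_def strongly_connected_on_def)

lemma end_component_subset: "end_component P X \<Longrightarrow> X \<subseteq> vertices P"
  by (simp add: end_component_def)

lemma end_component_random:
  "end_component P X \<Longrightarrow> v \<in> X \<Longrightarrow> v \<in> random P \<Longrightarrow> (v, u) \<in> edges P \<Longrightarrow> u \<in> X"
  by (simp add: end_component_def)

lemma end_component_path:
  "end_component P X \<Longrightarrow> u \<in> X \<Longrightarrow> v \<in> X \<Longrightarrow> (u, v) \<in> (edges P \<inter> X \<times> X)\<^sup>*"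
  by (simp add: end_component_def strongly_connected_on_def)

text \<open>Some edge of a path inside \<open>X\<close> from \<open>A\<close> to its complement must
  cross. This obstruction underlies both the trimming of components and the separation by
  layers.\<close>

lemma end_component_edge_out:
  assumes "end_component P X" "A \<inter> X \<noteq> {}" "\<not> X \<subseteq> A"
  obtains a b where "(a, b) \<in> edges P" "a \<in> A \<inter> X" "b \<in> X - A"
proof -
  obtain x y where xy: "x \<in> A \<inter> X" "y \<in> X" "y \<notin> A"
    using assms(2,3) by auto
  then have "(x, y) \<in> (edges P \<inter> X \<times> X)\<^sup>*"
    using assms(1) end_component_path by fastforce
  then obtain a b where "(a, b) \<in> edges P \<inter> X \<times> X" "a \<in> A" "b \<notin> A"
    by (rule rtrancl_leaves) (use xy in auto)
  then show ?thesis by (intro that) auto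
qed

text \<open>The common vertex \<open>v\<close> is a hub through which any two vertices of the union
  are joined.\<close>

lemma end_component_Un_Union:
  assumes "\<YY> \<noteq> {}" "\<And>Y. Y \<in> \<YY> \<Longrightarrow> end_component P Y \<and> v \<in> Y"
  shows "end_component P (\<Union>\<YY>)"
  unfolding end_component_def
proof (intro conjI)
  show "\<Union>\<YY> \<subseteq> vertices P"
    using assms(2) end_component_subset by blast
  show "strongly_connected_on (edges P) (\<Union>\<YY>)"
  proof (rule strongly_connected_onI[of v])
    show "v \<in> \<Union>\<YY>" using assms by blast
  next
    fix u assume "u \<in> \<Union>\<YY>"
    then obtain Y where Y: "Y \<in> \<YY>" "u \<in> Y" by auto
    then have "(v, u) \<in> (edges P \<inter> Y \<times> Y)\<^sup>*" "(u, v) \<in> (edges P \<inter> Y \<times> Y)\<^sup>*"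
      using assms(2) end_component_path by metis+
    then show "(v, u) \<in> (edges P \<inter> \<Union>\<YY> \<times> \<Union>\<YY>)\<^sup>*" "(u, v) \<in> (edges P \<inter> \<Union>\<YY> \<times> \<Union>\<YY>)\<^sup>*"
      using Y(1) by (blast intro: rtrancl_restrict_mono)+
  qed
  show "\<forall>v\<in>\<Union>\<YY> \<inter> random P. \<forall>u. (v, u) \<in> edges P \<longrightarrow> u \<in> \<Union>\<YY>"
    using assms(2) end_component_random by (metis Int_iff Union_iff)
qed

text \<open>
  Since overlapping end-components have an end-component as their union, this is an
  equivalence relation on its domain, whose classes are the maximal end-components inside \<open>U\<close>.
\<close>

definition ec_rel :: "'v mdp \<Rightarrow> 'v set \<Rightarrow> ('v \<times> 'v) set" where
  "ec_rel P U = {(u, v). \<exists>Y. end_component P Y \<and> Y \<subseteq> U \<and> u \<in> Y \<and> v \<in> Y}"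

lemma ec_relI: "end_component P Y \<Longrightarrow> Y \<subseteq> U \<Longrightarrow> u \<in> Y \<Longrightarrow> v \<in> Y \<Longrightarrow> (u, v) \<in> ec_rel P U"
  by (auto simp: ec_rel_def)

lemma ec_relE:
  assumes "(u, v) \<in> ec_rel P U"
  obtains Y where "end_component P Y" "Y \<subseteq> U" "u \<in> Y" "v \<in> Y"
  using assms by (auto simp: ec_rel_def)

lemma ec_rel_mono: "U \<subseteq> U' \<Longrightarrow> ec_rel P U \<subseteq> ec_rel P U'"
  unfolding ec_rel_def by blast

lemma ec_rel_sym: "(u, v) \<in> ec_rel P U \<Longrightarrow> (v, u) \<in> ec_rel P U"
  unfolding ec_rel_def by blast

lemma ec_rel_subset: "(u, v) \<in> ec_rel P U \<Longrightarrow> u \<in> U \<and> v \<in> U \<and> u \<in> vertices P \<and> v \<in> vertices P"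
  unfolding ec_rel_def using end_component_subset by blast

lemma ec_rel_class:
  assumes "(v, w) \<in> ec_rel P U"
  shows "end_component P (ec_rel P U `` {v})" "v \<in> ec_rel P U `` {v}" "ec_rel P U `` {v} \<subseteq> U"
proof -
  have eq: "ec_rel P U `` {v} = \<Union>{Y. end_component P Y \<and> Y \<subseteq> U \<and> v \<in> Y}"
    by (auto simp: ec_rel_def)
  show "end_component P (ec_rel P U `` {v})"
    unfolding eq by (rule end_component_Un_Union) (use assms in \<open>auto simp: ec_rel_def\<close>)
  show "v \<in> ec_rel P U `` {v}" "ec_rel P U `` {v} \<subseteq> U"
    using assms by (auto simp: ec_rel_def)
qed

lemma ec_rel_trans:
  assumes "(u, v) \<in> ec_rel P U" "(v, w) \<in> ec_rel P U"
  shows "(u, w) \<in> ec_rel P U"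
  by (rule ec_relI[OF ec_rel_class(1)[OF assms(2)]])
    (use ec_rel_class(3)[OF assms(2)] assms ec_rel_sym in auto)

lemma ec_rel_class_eq:
  assumes "(u, v) \<in> ec_rel P U"
  shows "ec_rel P U `` {u} = ec_rel P U `` {v}"
  by (auto dest: ec_rel_trans[OF assms] ec_rel_trans[OF ec_rel_sym[OF assms]])

lemma end_component_subset_class:
  "end_component P Y \<Longrightarrow> Y \<subseteq> U \<Longrightarrow> v \<in> Y \<Longrightarrow> Y \<subseteq> ec_rel P U `` {v}"
  by (auto intro: ec_relI)

lemma end_component_singleton: "is_mdp P \<Longrightarrow> v \<in> player1 P \<Longrightarrow> end_component P {v}"
  by (auto simp: end_component_def strongly_connected_on_def is_mdp_def)

text \<open>A player-1 vertex is a trivial end-component on its own. Trimming can therefore treat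
  every vertex of \<open>U\<close> outside the domain of the relation as random.\<close>

lemma mdp_random_if_not_ec:
  assumes "is_mdp P" "v \<in> U" "v \<in> vertices P" "v \<notin> Domain (ec_rel P U)"
  shows "v \<in> random P"
proof (rule ccontr)
  assume "v \<notin> random P"
  then have "v \<in> player1 P"
    using assms(1,3) by (auto simp: is_mdp_def)
  then have "(v, v) \<in> ec_rel P U"
    using end_component_singleton[OF assms(1)] assms(2) by (auto intro: ec_relI)
  then show False using assms(4) by auto
qed

section \<open>Maximal end-components as the classes of the relation on all vertices\<close>

lemma max_end_component_iff:
  "max_end_component P X \<longleftrightarrow>
     (\<exists>v. v \<in> Domain (ec_rel P (vertices P)) \<and> X = ec_rel P (vertices P) `` {v})"
proof
  assume X: "max_end_component P X"
  then obtain v where v: "v \<in> X"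
    by (auto simp: max_end_component_def dest: end_component_not_empty)
  have X': "end_component P X"
    using X by (simp add: max_end_component_def)
  then have vv: "(v, v) \<in> ec_rel P (vertices P)"
    using v end_component_subset by (blast intro: ec_relI)
  have "X \<subseteq> ec_rel P (vertices P) `` {v}"
    using X' v end_component_subset end_component_subset_class by metis
  then have "X = ec_rel P (vertices P) `` {v}"
    using X ec_rel_class(1)[OF vv] by (auto simp: max_end_component_def)
  then show "\<exists>v. v \<in> Domain (ec_rel P (vertices P)) \<and> X = ec_rel P (vertices P) `` {v}"
    using vv by blast
next
  assume "\<exists>v. v \<in> Domain (ec_rel P (vertices P)) \<and> X = ec_rel P (vertices P) `` {v}"
  then obtain v w where v: "(v, w) \<in> ec_rel P (vertices P)" "X = ec_rel P (vertices P) `` {v}"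
    by auto
  have "Y = X" if "end_component P Y" "X \<subseteq> Y" for Y
    using that v ec_rel_class(2)[OF v(1)] end_component_subset[of P Y]
      end_component_subset_class[of P Y "vertices P" v] by auto
  then show "max_end_component P X"
    using v ec_rel_class(1)[OF v(1)] by (auto simp: max_end_component_def)
qed

lemma Union_max_end_components:
  "\<Union>{X. max_end_component P X} = Domain (ec_rel P (vertices P))"
proof (intro equalityI subsetI)
  fix x assume "x \<in> \<Union>{X. max_end_component P X}"
  then obtain v where "(v, x) \<in> ec_rel P (vertices P)"
    by (auto simp: max_end_component_iff)
  then show "x \<in> Domain (ec_rel P (vertices P))"
    by (rule DomainI[OF ec_rel_sym])
next
  fix x assume x: "x \<in> Domain (ec_rel P (vertices P))"
  then show "x \<in> \<Union>{X. max_end_component P X}"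
  proof -
    obtain w where w: "(x, w) \<in> ec_rel P (vertices P)" using x by auto
    then have "max_end_component P (ec_rel P (vertices P) `` {x})"
      by (auto simp: max_end_component_iff)
    then show ?thesis using ec_rel_class(2)[OF w] by blast
  qed
qed


section \<open>Adding a vertex\<close>

text \<open>What one round of trimming removes. The first part consists of vertices in no known
  component, hence random if they lie in \<open>U\<close>, that have an edge out of
  \<open>S\<close>. The second consists of the known components without an edge of
  \<open>edges P - R\<close> into \<open>S\<close>, that is, without an edge to other vertices of
  \<open>S\<close>.\<close>

definition untrimmed ::
    "'v mdp \<Rightarrow> ('v \<times> 'v) set \<Rightarrow> 'v \<Rightarrow> 'v set \<Rightarrow> 'v set" where
  "untrimmed P R t S =
     ((edges P)\<inverse> `` (vertices P - S) \<inter> S - {t} - Domain R) \<union>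
     (S \<inter> Domain R - R\<inverse> `` ((edges P - R)\<inverse> `` S))"

definition trim_inv :: "'v mdp \<Rightarrow> 'v set \<Rightarrow> 'v \<Rightarrow> 'v set \<Rightarrow> bool" where
  "trim_inv P U t S \<longleftrightarrow> S \<subseteq> insert t U \<and> t \<in> S \<and>
     ec_rel P (insert t U) `` {t} \<subseteq> S \<and> (\<forall>y z. y \<in> S \<longrightarrow> (y, z) \<in> ec_rel P U \<longrightarrow> z \<in> S)"

locale vertex_addition =
  fixes P :: "'v mdp" and U :: "'v set" and t :: 'v
  assumes mdp: "is_mdp P" and U: "U \<subseteq> vertices P" and t: "t \<in> vertices P" "t \<notin> U"
begin

abbreviation "R \<equiv> ec_rel P U"
abbreviation "C \<equiv> ec_rel P (insert t U) `` {t}"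

lemma t_not_Domain: "t \<notin> Domain R"
  using t by (auto dest: ec_rel_subset)

lemma C_end_component:
  assumes "C \<noteq> {}"
  shows "end_component P C" "t \<in> C"
proof -
  obtain w where "(t, w) \<in> ec_rel P (insert t U)" using assms by auto
  then show "end_component P C" "t \<in> C" by (rule ec_rel_class)+
qed

lemma trim_inv_init: "trim_inv P U t (insert t U)"
  unfolding trim_inv_def by (auto dest: ec_rel_subset)

lemma untrimmed_subset: "untrimmed P R t S \<subseteq> S"
  by (auto simp: untrimmed_def)

text \<open>No vertex \<open>y\<close> of \<open>C\<close> is removed. If \<open>y\<close> is in no
  known component, it is random or \<open>t\<close>, and the successors of a random vertex of
  \<open>C\<close> lie in \<open>C\<close>. Otherwise the known component of \<open>y\<close> lies
  in \<open>C\<close> but misses \<open>t\<close>, so strong connectivity of \<open>C\<close> gives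
  it an edge to the rest of \<open>C\<close>.\<close>

lemma trim_inv_step:
  assumes inv: "trim_inv P U t S"
  shows "trim_inv P U t (S - untrimmed P R t S)"
proof -
  have S: "S \<subseteq> insert t U" "t \<in> S" "C \<subseteq> S" and sat: "\<And>y z. y \<in> S \<Longrightarrow> (y, z) \<in> R \<Longrightarrow> z \<in> S"
    using inv unfolding trim_inv_def by blast+
  have "y \<notin> untrimmed P R t S" if y: "y \<in> C" for y
  proof
    assume un: "y \<in> untrimmed P R t S"
    have EC: "end_component P C" "t \<in> C"
      using y C_end_component by auto
    show False
    proof (cases "y \<in> Domain R")
      case False
      then obtain u where u: "(y, u) \<in> edges P" "u \<notin> S" "y \<noteq> t"
        using un by (auto simp: untrimmed_def)
      then have "y \<in> U" "y \<in> vertices P"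
        using y S U by auto
      then have "y \<in> random P"
        using False mdp_random_if_not_ec[OF mdp] by metis
      then have "u \<in> C"
        using end_component_random[OF EC(1) y _ u(1)] by simp
      then show False using u(2) S(3) by auto
    next
      case True
      let ?M = "R `` {y}"
      obtain z where z: "(y, z) \<in> R" using True by auto
      have M: "end_component P ?M" "y \<in> ?M" "?M \<subseteq> U"
        using ec_rel_class[OF z] by auto
      have MC: "?M \<subseteq> C"
      proof -
        have "(t, y) \<in> ec_rel P (insert t U)" using y by auto
        moreover have "R \<subseteq> ec_rel P (insert t U)" by (rule ec_rel_mono) auto
        ultimately show ?thesis by (auto intro: ec_rel_trans[of t y])
      qed
      obtain a b where ab: "(a, b) \<in> edges P" "a \<in> ?M \<inter> C" "b \<in> C - ?M"
        using end_component_edge_out[OF EC(1), of ?M] M(2,3) y EC(2) t(2) by blast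
      have "(a, b) \<notin> R"
        using ab ec_rel_trans[of y a P U b] by auto
      then have "y \<in> R\<inverse> `` ((edges P - R)\<inverse> `` S)"
        using ab S(3) ec_rel_sym[of y a] by fastforce
      then show False using un True by (auto simp: untrimmed_def)
    qed
  qed
  then have 1: "C \<subseteq> S - untrimmed P R t S"
    using S(3) by blast
  have 2: "z \<in> S - untrimmed P R t S" if "y \<in> S - untrimmed P R t S" "(y, z) \<in> R" for y z
  proof -
    have y: "y \<in> S" "y \<in> Domain R" using that by auto
    then have "y \<in> R\<inverse> `` ((edges P - R)\<inverse> `` S)"
      using that(1) by (auto simp: untrimmed_def)
    then obtain a where a: "(y, a) \<in> R" "a \<in> (edges P - R)\<inverse> `` S" by auto
    then have "(z, a) \<in> R"
      using that(2) ec_rel_sym ec_rel_trans by metis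
    moreover have "z \<in> S" using sat[OF y(1) that(2)] .
    ultimately show ?thesis
      using a(2) by (auto simp: untrimmed_def)
  qed
  have 3: "t \<in> S - untrimmed P R t S"
    using S(2) t_not_Domain by (auto simp: untrimmed_def)
  show ?thesis
    unfolding trim_inv_def using S(1) 1 2 3 by blast
qed

context
  fixes S
  assumes inv: "trim_inv P U t S" and fixpoint: "untrimmed P R t S = {}"
begin

lemma S_props:
  "S \<subseteq> insert t U" "t \<in> S" "C \<subseteq> S" "\<And>y z. y \<in> S \<Longrightarrow> (y, z) \<in> R \<Longrightarrow> z \<in> S"
  using inv unfolding trim_inv_def by blast+

text \<open>For a vertex of a known component this is closure of that component together with
  saturation of \<open>S\<close>; for any other vertex it is emptiness of the first part of
  \<open>untrimmed\<close>. Trimming spares \<open>t\<close>, whose edges are tested separately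
  afterwards.\<close>

lemma S_random_closed:
  assumes v: "v \<in> S" "v \<noteq> t" "v \<in> random P" and e: "(v, u) \<in> edges P"
  shows "u \<in> S"
proof (cases "v \<in> Domain R")
  case True
  then obtain z where z: "(v, z) \<in> R" by auto
  have "u \<in> R `` {v}"
    using end_component_random[OF ec_rel_class(1)[OF z] ec_rel_class(2)[OF z] v(3) e] .
  then show ?thesis using S_props(4) v(1) by auto
next
  case False
  have "u \<in> vertices P" using mdp e by (auto simp: is_mdp_def)
  then show ?thesis
    using fixpoint v e False by (auto simp: untrimmed_def)
qed

text \<open>Otherwise the vertices of \<open>S\<close> that cannot reach \<open>t\<close> contain a bottom strongly connected
  component, which is an end-component of \<open>U\<close> and yet has an edge out of its \<open>R\<close>-class.\<close>

lemma S_reaches: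
  assumes "x \<in> S"
  shows "(x, t) \<in> (edges P \<inter> S \<times> S)\<^sup>*"
proof (rule ccontr)
  let ?E = "edges P \<inter> S \<times> S"
  assume x: "(x, t) \<notin> ?E\<^sup>*"
  define Y where "Y = {y \<in> S. (y, t) \<notin> ?E\<^sup>*}"
  define reach where "reach = (\<lambda>y. ?E\<^sup>* `` {y})"
  have "finite (vertices P)" using mdp by (simp add: is_mdp_def)
  then have "finite S"
    using S_props(1) U t(1) by (meson finite_subset insert_subset)
  have Yclosed: "z \<in> Y" if "y \<in> Y" "(y, z) \<in> ?E\<^sup>*" for y z
    using that(2,1)
  proof (induction rule: rtrancl_induct)
    case (step a b)
    then show ?case
      by (auto simp: Y_def intro: converse_rtrancl_into_rtrancl)
  qed
  have reach_Y: "reach y \<subseteq> Y" if "y \<in> Y" for y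
    using that Yclosed by (auto simp: reach_def)
  have "Y \<noteq> {}" using x assms by (auto simp: Y_def)
  have tY: "t \<notin> Y" by (auto simp: Y_def)
  \<comment> \<open>A reachable set of least cardinality is a bottom component: what any of its
    vertices reaches is contained in it, hence equal to it, and so includes \<open>y\<close>
    again.\<close>
  obtain y where y: "y \<in> Y" "\<And>z. z \<in> Y \<Longrightarrow> card (reach y) \<le> card (reach z)"
    using \<open>Y \<noteq> {}\<close> ex_has_least_nat[of "\<lambda>y. y \<in> Y" _ "\<lambda>y. card (reach y)"] by blast
  let ?B = "reach y"
  have BY: "?B \<subseteq> Y" using reach_Y y(1) .
  have yB: "y \<in> ?B" by (simp add: reach_def)
  have BS: "?B \<subseteq> S" using BY by (auto simp: Y_def)
  have Bclosed: "b \<in> ?B" if "a \<in> ?B" "(a, b) \<in> edges P" "b \<in> S" for a b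
    using that BS by (auto simp: reach_def intro: rtrancl.rtrancl_into_rtrancl)
  have returns: "(z, y) \<in> ?E\<^sup>*" if z: "z \<in> ?B" for z
  proof -
    have "reach z \<subseteq> ?B"
      using z by (auto simp: reach_def)
    moreover have "finite ?B" using BS \<open>finite S\<close> by (rule finite_subset)
    moreover have "card ?B \<le> card (reach z)" using y(2) z BY by blast
    ultimately have "reach z = ?B" by (simp add: card_seteq)
    then show ?thesis using yB by (auto simp: reach_def)
  qed
  have "end_component P ?B"
    unfolding end_component_def
  proof (intro conjI ballI allI impI)
    show "?B \<subseteq> vertices P" using BS S_props(1) U t(1) by auto
    show "strongly_connected_on (edges P) ?B"
    proof (rule strongly_connected_onI[OF yB])
      fix z assume z: "z \<in> ?B"
      then show "(y, z) \<in> (edges P \<inter> ?B \<times> ?B)\<^sup>*"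
        unfolding reach_def by (intro rtrancl_restrict_Image) auto
      show "(z, y) \<in> (edges P \<inter> ?B \<times> ?B)\<^sup>*"
        by (rule rtrancl_restrict_Image_target[OF returns[OF z] z BS]) (use Bclosed in blast)
    qed
    fix v u assume v: "v \<in> ?B \<inter> random P" and "(v, u) \<in> edges P"
    moreover have "v \<noteq> t" using v BY tY by auto
    ultimately have "u \<in> S" using S_random_closed BS by blast
    then show "u \<in> ?B" using Bclosed v \<open>(v, u) \<in> edges P\<close> by blast
  qed
  moreover have "?B \<subseteq> U"
    using BS S_props(1) BY tY by auto
  ultimately have BR: "?B \<subseteq> R `` {y}"
    using yB by (intro end_component_subset_class)
  then have "y \<in> S \<inter> Domain R"
    using yB BS by auto
  then have "y \<in> R\<inverse> `` ((edges P - R)\<inverse> `` S)"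
    using fixpoint by (auto simp: untrimmed_def)
  then obtain a b where ab: "(y, a) \<in> R" "(a, b) \<in> edges P" "(a, b) \<notin> R" "b \<in> S" by auto
  have "a \<in> ?B"
  proof -
    have "y \<in> S" using yB BS by blast
    then have "R `` {y} \<subseteq> S" by (auto intro: S_props(4))
    have "(y, a) \<in> (edges P \<inter> R `` {y} \<times> R `` {y})\<^sup>*"
      by (rule end_component_path[OF ec_rel_class(1,2)[OF ab(1)]]) (use ab(1) in simp)
    then have "(y, a) \<in> ?E\<^sup>*"
      using \<open>R `` {y} \<subseteq> S\<close> by (rule rtrancl_restrict_mono)
    then show ?thesis by (simp add: reach_def)
  qed
  then have "b \<in> ?B" using Bclosed ab by blast
  then have "(y, b) \<in> R" using BR by auto
  then show False using ab ec_rel_sym ec_rel_trans by metis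
qed

text \<open>End-components through \<open>t\<close> lie in \<open>C\<close>, and all others already
  lie in \<open>U\<close>.\<close>

lemma ec_rel_insert_eq: "ec_rel P (insert t U) = R \<union> C \<times> C"
proof (intro equalityI subsetI)
  fix p assume "p \<in> ec_rel P (insert t U)"
  then obtain x y Y where Y: "p = (x, y)" "end_component P Y" "Y \<subseteq> insert t U" "x \<in> Y" "y \<in> Y"
    by (cases p) (auto elim: ec_relE)
  show "p \<in> R \<union> C \<times> C"
  proof (cases "t \<in> Y")
    case True
    then have "Y \<subseteq> C" using Y by (intro end_component_subset_class)
    then show ?thesis using Y by auto
  next
    case False
    then have "Y \<subseteq> U" using Y by auto
    then show ?thesis using Y by (auto intro: ec_relI)
  qed
next
  fix p assume "p \<in> R \<union> C \<times> C"
  moreover have "R \<subseteq> ec_rel P (insert t U)" by (rule ec_rel_mono) auto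
  moreover have "C \<times> C \<subseteq> ec_rel P (insert t U)"
    by (auto intro: ec_rel_trans[OF ec_rel_sym])
  ultimately show "p \<in> ec_rel P (insert t U)" by blast
qed

text \<open>An end-component through the random vertex \<open>t\<close> would contain
  \<open>u\<close>, but it would also lie in \<open>S\<close>. Hence \<open>C\<close> is
  empty.\<close>

lemma ec_rel_insert_random:
  assumes "t \<in> random P" "(t, u) \<in> edges P" "u \<notin> S"
  shows "ec_rel P (insert t U) = R"
proof -
  have "C = {}"
  proof (rule ccontr)
    assume "C \<noteq> {}"
    then have "end_component P C" "t \<in> C"
      by (rule C_end_component)+
    then have "u \<in> C"
      using assms(1,2) by (rule end_component_random)
    then show False using S_props(3) assms(3) by auto
  qed
  then show ?thesis using ec_rel_insert_eq by simp
qed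

text \<open>Every vertex of \<open>S\<close> reaches \<open>t\<close>, so what \<open>t\<close>
  reaches inside \<open>S\<close> is strongly connected, and it is closed for random vertices.
  Conversely \<open>t\<close> reaches all of \<open>C\<close> within \<open>C\<close>, which is part
  of \<open>S\<close>.\<close>

lemma ec_rel_insert_reach:
  assumes "t \<in> random P \<Longrightarrow> edges P `` {t} \<subseteq> S"
  defines "A \<equiv> (edges P \<inter> S \<times> S)\<^sup>* `` {t}"
  shows "ec_rel P (insert t U) = R \<union> A \<times> A"
proof -
  have AS: "A \<subseteq> S"
    using S_props(2) unfolding A_def by (auto elim: rtranclE)
  have tA: "t \<in> A" by (simp add: A_def)
  have closed: "b \<in> A" if "a \<in> A" "(a, b) \<in> edges P" "b \<in> S" for a b
    using that AS by (auto simp: A_def intro: rtrancl.rtrancl_into_rtrancl)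
  have "end_component P A"
    unfolding end_component_def
  proof (intro conjI ballI allI impI)
    show "A \<subseteq> vertices P" using AS S_props(1) U t(1) by auto
    show "strongly_connected_on (edges P) A"
    proof (rule strongly_connected_onI[OF tA])
      fix z assume z: "z \<in> A"
      then show "(t, z) \<in> (edges P \<inter> A \<times> A)\<^sup>*"
        unfolding A_def by (intro rtrancl_restrict_Image) auto
      have "z \<in> S" using z AS by auto
      show "(z, t) \<in> (edges P \<inter> A \<times> A)\<^sup>*"
        by (rule rtrancl_restrict_Image_target[OF S_reaches[OF \<open>z \<in> S\<close>] z AS])
          (use closed in blast)
    qed
    fix v u assume v: "v \<in> A \<inter> random P" and "(v, u) \<in> edges P"
    then have "u \<in> S"
      using S_random_closed[of v u] AS assms(1) by (cases "v = t") auto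
    then show "u \<in> A" using closed v \<open>(v, u) \<in> edges P\<close> by blast
  qed
  then have "A \<subseteq> C"
    using AS S_props(1) tA by (intro end_component_subset_class) auto
  moreover have "C \<subseteq> A"
  proof
    fix z assume z: "z \<in> C"
    then have "C \<noteq> {}" by blast
    then have "end_component P C" "t \<in> C"
      by (rule C_end_component)+
    then have "(t, z) \<in> (edges P \<inter> C \<times> C)\<^sup>*"
      using z by (rule end_component_path)
    then show "z \<in> A"
      unfolding A_def using rtrancl_restrict_mono[OF _ S_props(3)] by blast
  qed
  ultimately show ?thesis using ec_rel_insert_eq by simp
qed

end

end

section \<open>Searching for a thin layer\<close>

text \<open>
  The difference of logarithms depends on the number \<open>a\<close> of vertices passed by the search. It
  lies between \<open>- ln (x + 1)\<close> and \<open>ln (x + 1)\<close>, which bounds the number of layers that are not thin.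
\<close>

lemma nonthin_potential:
  fixes q :: real and a l x :: nat
  assumes q: "0 \<le> q" and l: "1 \<le> l" and x: "a + l \<le> x"
    and nonthin: "real a < q * real l \<or> real (x - a - l) < q * real l"
  shows "ln (1 + 1 / (q + 1)) + (ln (real a + 1) - ln (real x - real a + 1))
    \<le> ln (real (a + l) + 1) - ln (real x - real (a + l) + 1)"
proof -
  define f where "f = 1 + 1 / (q + 1)"
  have growth: "f * (r + 1) \<le> r + real l + 1" if "0 \<le> r" "r < q * real l" for r
  proof -
    \<comment> \<open>The bound \<open>1 \<le> l\<close> absorbs the additive 1, which is there to
      keep the logarithms defined at zero.\<close>
    have "r + 1 \<le> q * real l + real l" using that l by linarith
    then have "(r + 1) / (q + 1) \<le> real l"
      using q by (simp add: divide_le_eq algebra_simps)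
    then show ?thesis by (simp add: f_def algebra_simps)
  qed
  have f: "0 < f" using q by (simp add: f_def add_pos_pos)
  have ln_growth: "ln f + ln (r + 1) \<le> ln (r + real l + 1)" if "0 \<le> r" "r < q * real l" for r
  proof -
    have "ln f + ln (r + 1) = ln (f * (r + 1))"
      using f that by (simp add: ln_mult)
    also have "\<dots> \<le> ln (r + real l + 1)"
      using growth[OF that] f that by simp
    finally show ?thesis .
  qed
  define b where "b = real x - real a - real l"
  have b: "0 \<le> b" "real (x - a - l) = b"
    using x by (simp_all add: b_def of_nat_diff)
  have mono: "ln (real a + 1) \<le> ln (real a + real l + 1)" "ln (b + 1) \<le> ln (b + real l + 1)"
    using b by simp_all
  \<comment> \<open>Either the passed part grows by the factor \<open>f\<close>, or the remainder
    shrinks by it. The other logarithm moves in the favourable direction by monotonicity.\<close>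
  have "ln f + (ln (real a + 1) - ln (b + real l + 1)) \<le> ln (real a + real l + 1) - ln (b + 1)"
    using nonthin
  proof
    assume "real a < q * real l"
    from ln_growth[OF _ this] mono show ?thesis by simp
  next
    assume "real (x - a - l) < q * real l"
    then have "b < q * real l" using b(2) by simp
    from ln_growth[OF b(1) this] mono(1) show ?thesis by linarith
  qed
  then show ?thesis by (simp add: f_def b_def algebra_simps)
qed

definition entropy :: "nat \<Rightarrow> real" where
  "entropy k = real k * log 2 (real k)"

lemma entropy_0 [simp]: "entropy 0 = 0"
  by (simp add: entropy_def)

lemma entropy_nonneg: "0 \<le> entropy k"
  by (cases "k = 0") (auto simp: entropy_def)

text \<open>
  A separating layer of size \<open>l\<close> is charged to the smaller part; a vertex is in the smaller part
  at most \<open>log 2 n\<close> times.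
\<close>

lemma entropy_split_le:
  fixes q :: real
  assumes "q * real l \<le> real a" "q * real l \<le> real b" "a + b \<le> x"
  shows "q * real l + entropy a + entropy b \<le> entropy x"
  using assms
proof (induction a b rule: linorder_wlog)
  case (le a b)
  show ?case
  proof (cases "b = 0")
    case True
    then show ?thesis using le entropy_nonneg[of x] by simp
  next
    case False
    then have x: "0 < x" using le by simp
    \<comment> \<open>The smaller part has at most half of the vertices, so each of its
      \<open>a\<close> vertices saves one unit of the binary logarithm. This saving of
      \<open>a\<close> pays for \<open>q * l\<close>.\<close>
    have "entropy a \<le> real a * (log 2 (real x) - 1)"
    proof (cases "a = 0")
      case False
      have "log 2 (2 * real a) \<le> log 2 (real x)"
        using le False by (subst log_le_cancel_iff) auto
      then have "log 2 (real a) \<le> log 2 (real x) - 1"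
        using False by (simp add: log_mult)
      then show ?thesis unfolding entropy_def by (intro mult_left_mono) auto
    qed simp
    moreover have "entropy b \<le> real b * log 2 (real x)"
      unfolding entropy_def using False le by (intro mult_left_mono) auto
    moreover have "real (a + b) * log 2 (real x) \<le> entropy x"
      unfolding entropy_def using le x by (intro mult_right_mono) auto
    moreover have "q * real l \<le> real a" by fact
    ultimately show ?thesis by (simp add: algebra_simps)
  qed
next
  case (sym a b)
  then show ?case by (simp add: algebra_simps)
qed

text \<open>
  Cells of the store: 4 the empty set, 5 the vertices in blocks, 6 the relation of the blocks,
  7 the separator, 8 the relation of the components found, 9 a picked vertex, 10 the set being
  searched or trimmed, 11 the vertices passed by a search, 12 its current layer, 13 to 15
  scratch, 16 the domain of 8, 17 the edges outside 8. Cells of the memory: 2, 3, 4 the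
  cardinalities of 10, 11, 12; 5 and 6 answers of tests.

  Cell 1 of the memory holds a number \<open>N\<close> such that a search stops at a layer \<open>L\<close> with
  \<open>N * |L|\<^sup>2 \<le> min |A|\<^sup>2 |B|\<^sup>2\<close>, where \<open>A\<close> and \<open>B\<close> are the parts before and behind \<open>L\<close>. For
  \<open>N = n\<close> this finds thin layers; for \<open>N = n\<^sup>2 + 1\<close> it forces \<open>L = {}\<close>, so that the search
  computes everything reachable.
\<close>

definition search :: "setop \<Rightarrow> com" where
  "search f =
     set_op 11 Cup 4 4 ;; set_op 12 Cup 9 9 ;; Card (Const 2) (Const 10) ;;
     Store (Const 3) (Const 0) ;; Store (Const 4) (Const 1) ;;
     While (Add (Less (Mul (var 3) (var 3)) (Mul (var 1) (Mul (var 4) (var 4))))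
         (Less (Mul (Sub (Sub (var 2) (var 3)) (var 4)) (Sub (Sub (var 2) (var 3)) (var 4)))
           (Mul (var 1) (Mul (var 4) (var 4)))))
      (set_op 11 Cup 11 12 ;;
       set_op 14 f 1 12 ;; set_op 14 Cap 14 10 ;; set_op 12 Setminus 14 11 ;;
       Card (Const 3) (Const 11) ;; Card (Const 4) (Const 12))"

text \<open>The facts kept from breadth-first search: edges leave \<open>A\<close> inside
  \<open>X\<close> only towards \<open>L\<close>, and all visited vertices are reachable from
  \<open>v\<close>. Distances are not recorded.\<close>

definition layered ::
    "('v \<times> 'v) set \<Rightarrow> 'v set \<Rightarrow> 'v \<Rightarrow> 'v set \<Rightarrow> 'v set \<Rightarrow> bool" where
  "layered F X v A L \<longleftrightarrow> A \<inter> L = {} \<and> v \<in> A \<union> L \<and> A \<union> L \<subseteq> X \<and>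
     A \<union> L \<subseteq> (F \<inter> X \<times> X)\<^sup>* `` {v} \<and> F `` A \<inter> X \<subseteq> A \<union> L"

definition same_except :: "nat set \<Rightarrow> nat set \<Rightarrow> 'v state \<Rightarrow> 'v state \<Rightarrow> bool" where
  "same_except rs ms s t \<longleftrightarrow> (\<forall>r. r \<notin> rs \<longrightarrow> store t r = store s r) \<and>
     (\<forall>m. m \<notin> ms \<longrightarrow> mem t m = mem s m) \<and> reported t = reported s"

lemma layered_init: "v \<in> X \<Longrightarrow> layered F X v {} {v}"
  by (auto simp: layered_def)

lemma layered_step:
  assumes "layered F X v A L"
  shows "layered F X v (A \<union> L) (F `` L \<inter> X - (A \<union> L))"
proof -
  have "F `` L \<inter> X \<subseteq> (F \<inter> X \<times> X)\<^sup>* `` {v}"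
  proof
    fix y assume "y \<in> F `` L \<inter> X"
    then obtain x where "x \<in> L" "(x, y) \<in> F" "y \<in> X" by auto
    then have "(v, x) \<in> (F \<inter> X \<times> X)\<^sup>*" "(x, y) \<in> F \<inter> X \<times> X"
      using assms by (auto simp: layered_def)
    then show "y \<in> (F \<inter> X \<times> X)\<^sup>* `` {v}"
      by (auto intro: rtrancl.rtrancl_into_rtrancl)
  qed
  then show ?thesis using assms by (auto simp: layered_def)
qed

text \<open>With an empty layer \<open>A\<close> is closed under the edges inside
  \<open>X\<close>.\<close>

lemma layered_reach:
  assumes "layered F X v A {}"
  shows "A = (F \<inter> X \<times> X)\<^sup>* `` {v}"
proof
  show "(F \<inter> X \<times> X)\<^sup>* `` {v} \<subseteq> A"
  proof
    fix y assume "y \<in> (F \<inter> X \<times> X)\<^sup>* `` {v}"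
    then have "(v, y) \<in> (F \<inter> X \<times> X)\<^sup>*" by auto
    then show "y \<in> A"
      by (induction rule: rtrancl_induct) (use assms in \<open>auto simp: layered_def\<close>)
  qed
qed (use assms in \<open>auto simp: layered_def\<close>)

text \<open>The linear bound serves the exhaustive searches, the logarithmic one the searches for
  thin layers. Each round raises a potential ranging over an interval of length
  \<open>2 * ln (x + 1)\<close> by at least the given logarithm.\<close>

definition search_steps :: "nat \<Rightarrow> nat \<Rightarrow> nat \<Rightarrow> bool" where
  "search_steps N x k \<longleftrightarrow> k \<le> x \<and>
     real k * ln (1 + 1 / (sqrt (real N) + 1)) \<le> 2 * ln (real x + 1)"

text \<open>The relation \<open>F\<close> stands for the edges or their converse, according to the
  one-step operation \<open>f\<close>. Initialisation costs 3 operations and each round 6; the two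
  thinness bounds are the negated loop guard.\<close>

lemma runs_search:
  assumes reg: "store s 1 = Some (ESet E)" "store s 4 = Some (VSet {})"
      "store s 9 = Some (VSet {v})" "store s 10 = Some (VSet X)"
    and v: "v \<in> X" and fin: "finite X"
    and f: "\<And>S. setop_result f (ESet E) (VSet S) = Some (VSet (F `` S))"
    and Q: "\<And>t A L k. \<lbrakk>same_except {11, 12, 14} {2, 3, 4} s t;
        store t 11 = Some (VSet A); store t 12 = Some (VSet L);
        mem t 2 = card X; mem t 3 = card A; layered F X v A L;
        mem s 1 * (card L)\<^sup>2 \<le> (card A)\<^sup>2; mem s 1 * (card L)\<^sup>2 \<le> (card (X - A - L))\<^sup>2;
        num_ops t = num_ops s + 3 + 6 * k; search_steps (mem s 1) (card X) k\<rbrakk> \<Longrightarrow> Q t"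
  shows "runs pk (search f) s Q"
proof -
  define N where "N = mem s 1"
  define x where "x = card X"
  define \<delta> where "\<delta> = ln (1 + 1 / (sqrt (real N) + 1))"
  define p where "p = (\<lambda>a::nat. ln (real a + 1) - ln (real x - real a + 1))"
  \<comment> \<open>The potential starts at \<open>- ln (x + 1)\<close>, which explains the added
    logarithm. Moreover \<open>k \<le> card A\<close>, because every layer passed is
    non-empty.\<close>
  define I where "I = (\<lambda>(A, L, k) t. same_except {11, 12, 14} {2, 3, 4} s t \<and>
        store t 11 = Some (VSet A) \<and> store t 12 = Some (VSet L) \<and>
        mem t 2 = x \<and> mem t 3 = card A \<and> mem t 4 = card L \<and> layered F X v A L \<and>
        num_ops t = num_ops s + 3 + 6 * k \<and> k \<le> card A \<and> real k * \<delta> \<le> p (card A) + ln (real x + 1))"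
  define nonthin where "nonthin = (\<lambda>A L. (card A)\<^sup>2 < N * (card L)\<^sup>2 \<or> (card (X - A - L))\<^sup>2 < N * (card L)\<^sup>2)"
  have cards: "card (A \<union> L) = card A + card L" "card (X - A - L) = x - card A - card L"
      "card A + card L \<le> x" "finite A" "finite L" if "layered F X v A L" for A L
  proof -
    have *: "A \<inter> L = {}" "A \<union> L \<subseteq> X" using that by (auto simp: layered_def)
    then show fin': "finite A" "finite L" using fin by (auto intro: finite_subset)
    then show 1: "card (A \<union> L) = card A + card L" using * by (simp add: card_Un_disjoint)
    have "X - A - L = X - (A \<union> L)" by auto
    then show "card (X - A - L) = x - card A - card L"
      using 1 fin' * by (simp add: card_Diff_subset x_def)
    show "card A + card L \<le> x"
      using 1 card_mono[OF fin *(2)] by (simp add: x_def)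
  qed
  \<comment> \<open>The sum of two truth values acts as a disjunction, and comparing squares avoids
    square roots. The truncated subtractions are exact since \<open>A\<close> and \<open>L\<close>
    are disjoint parts of \<open>X\<close>.\<close>
  define guard where "guard = Add (Less (Mul (var 3) (var 3)) (Mul (var 1) (Mul (var 4) (var 4))))
         (Less (Mul (Sub (Sub (var 2) (var 3)) (var 4)) (Sub (Sub (var 2) (var 3)) (var 4)))
           (Mul (var 1) (Mul (var 4) (var 4))))"
  have guard: "aval guard (mem t) \<noteq> 0 \<longleftrightarrow> nonthin A L" if "I (A, L, k) t" for A L k t
    using that cards[of A L]
    by (auto simp: guard_def I_def nonthin_def same_except_def power2_eq_square N_def)
  have loop: "runs pk (While guard
      (set_op 11 Cup 11 12 ;;
       set_op 14 f 1 12 ;; set_op 14 Cap 14 10 ;; set_op 12 Setminus 14 11 ;;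
       Card (Const 3) (Const 11) ;; Card (Const 4) (Const 12))) t Q"
    if init: "I ({}, {v}, 0) t" for t
  proof (rule runs_While[where I = I and f = "\<lambda>(A, L, k). x - card A", OF init], goal_cases)
    case (1 g t)
    obtain A L k where g: "g = (A, L, k)" by (cases g)
    have It: "I (A, L, k) t" using 1 g by simp
    have lay: "layered F X v A L" using It by (simp add: I_def)
    have nt: "nonthin A L" using guard[OF It] 1 by simp
    \<comment> \<open>An empty layer passes both thinness tests, so a layer that fails one is
      non-empty. This also makes the measure decrease.\<close>
    have l: "1 \<le> card L" using nt by (cases "card L = 0") (auto simp: nonthin_def)
    note c = cards[OF lay]
    have root: "a < sqrt (real N) * real (card L)" if "a\<^sup>2 < N * (card L)\<^sup>2" for a
    proof -
      have "real (a\<^sup>2) < real (N * (card L)\<^sup>2)" using that by (simp only: of_nat_less_iff)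
      then have "(real a)\<^sup>2 < (sqrt (real N) * real (card L))\<^sup>2"
        by (simp add: power_mult_distrib)
      then show ?thesis by (rule power_less_imp_less_base) simp
    qed
    have "\<delta> + p (card A) \<le> p (card A + card L)"
      unfolding \<delta>_def p_def
      by (rule nonthin_potential[OF _ l c(3)])
        (use nt root c(2) in \<open>auto simp: nonthin_def\<close>)
    moreover have "real k * \<delta> \<le> p (card A) + ln (real x + 1)" using It by (simp add: I_def)
    ultimately have pot: "real (Suc k) * \<delta> \<le> p (card A + card L) + ln (real x + 1)"
      by (simp add: algebra_simps)
    let ?A = "A \<union> L" and ?L = "F `` L \<inter> X - (A \<union> L)"
    have regs: "store t 1 = Some (ESet E)" "store t 10 = Some (VSet X)"
      using It reg by (auto simp: I_def same_except_def)
    show ?case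
      using It regs layered_step[OF lay] c(1,3) l pot
      apply (simp add: f g I_def same_except_def)
      apply (intro conjI exI[of _ "Suc k"])
         apply simp_all
      done
  next
    case (2 g t)
    obtain A L k where g: "g = (A, L, k)" by (cases g)
    have It: "I (A, L, k) t" using 2 g by simp
    have thin: "\<not> nonthin A L" using guard[OF It] 2 by simp
    have lay: "layered F X v A L" using It by (simp add: I_def)
    have "real k * \<delta> \<le> 2 * ln (real x + 1)"
    proof -
      have "p (card A) \<le> ln (real x + 1)"
        using cards(3)[OF lay] unfolding p_def by (smt (verit) ln_ge_zero ln_le_cancel_iff of_nat_0_le_iff of_nat_add of_nat_le_iff)
      then show ?thesis using It by (simp add: I_def)
    qed
    moreover have "k \<le> x" using It cards(3)[OF lay] by (simp add: I_def)
    ultimately have "search_steps (mem s 1) (card X) k"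
      by (simp add: search_steps_def \<delta>_def N_def x_def)
    then show ?case
      using It thin by (intro Q[of t A L k]) (auto simp: I_def nonthin_def N_def x_def)
  qed
  show ?thesis
    unfolding search_def guard_def[symmetric]
    using reg
    apply (simp del: One_nat_def)
    apply (rule loop)
    using layered_init[OF v]
    apply (simp add: I_def same_except_def p_def x_def)
    done
qed

section \<open>Refining the blocks\<close>

definition blocks_rel :: "'v set set \<Rightarrow> ('v \<times> 'v) set" where
  "blocks_rel \<B> = (\<Union>X\<in>\<B>. X \<times> X)"

text \<open>Components in \<open>R\<close> lie outside the blocks, and every end-component avoiding
  \<open>T\<close> is accounted for by \<open>R\<close> or by a block; without blocks the two
  inclusions determine \<open>R\<close>. In the last clause the loss of entropy pays the square root
  of \<open>n\<close> for each separator vertex.\<close>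

definition blocks_inv ::
    "'v mdp \<Rightarrow> 'v set set \<Rightarrow> 'v set \<Rightarrow> ('v \<times> 'v) set \<Rightarrow> bool" where
  "blocks_inv P \<B> T R \<longleftrightarrow>
     disjoint \<B> \<and> {} \<notin> \<B> \<and> \<Union>\<B> \<subseteq> vertices P \<and> T \<subseteq> vertices P \<and> \<Union>\<B> \<inter> T = {} \<and>
     R \<subseteq> ec_rel P (vertices P - T - \<Union>\<B>) \<and>
     ec_rel P (vertices P - T) \<subseteq> R \<union> blocks_rel \<B> \<and>
     sqrt (real (card (vertices P))) * real (card T) + (\<Sum>X\<in>\<B>. entropy (card X))
       \<le> entropy (card (vertices P))"

text \<open>A common form for the three outcomes of a step. The set \<open>L\<close> leaves the
  blocks, its subset \<open>T\<close> joins the separator, and \<open>R\<close> holds the newly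
  found component. Discarding random vertices has \<open>T\<close> and \<open>R\<close> empty, a
  thin layer has \<open>T = L\<close>, and a block that is an end-component has
  \<open>L = X\<close>. The clause for empty \<open>L\<close> guarantees progress.\<close>

definition split_ok ::
    "'v mdp \<Rightarrow> 'v set \<Rightarrow> 'v set \<Rightarrow> 'v set \<Rightarrow> 'v set \<Rightarrow> ('v \<times> 'v) set \<Rightarrow> bool" where
  "split_ok P X A L T R \<longleftrightarrow> A \<inter> L = {} \<and> A \<union> L \<subseteq> X \<and> T \<subseteq> L \<and> (L = {} \<longrightarrow> A \<noteq> {} \<and> A \<noteq> X) \<and>
     R \<subseteq> ec_rel P (L - T) \<and>
     (\<forall>Y. end_component P Y \<longrightarrow> Y \<subseteq> X - T \<longrightarrow> Y \<subseteq> A \<or> Y \<subseteq> X - A - L \<or> Y \<times> Y \<subseteq> R) \<and>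
     sqrt (real (card (vertices P))) * real (card T) + entropy (card A) + entropy (card (X - A - L))
       \<le> entropy (card X)"

definition refine :: "'v set \<Rightarrow> 'v set \<Rightarrow> 'v set \<Rightarrow> 'v set set \<Rightarrow> 'v set set" where
  "refine X A B \<B> = \<B> - {X} \<union> ({A, B} - {{}})"

text \<open>The number of nodes of a full binary tree with \<open>card X\<close> leaves: it drops
  even when a block is split in two without losing a vertex.\<close>

definition block_potential :: "'v set set \<Rightarrow> nat" where
  "block_potential \<B> = (\<Sum>X\<in>\<B>. 2 * card X - 1)"

text \<open>For non-negative weights an inequality is enough, which covers empty parts, equal parts
  and overlaps with other blocks alike.\<close>

lemma sum_refine_le_real:
  fixes f :: "'v set \<Rightarrow> real"
  assumes "finite \<B>" "X \<in> \<B>" "\<And>Y. 0 \<le> f Y"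
  shows "sum f (refine X A B \<B>) + f X \<le> sum f \<B> + f A + f B"
proof -
  have "sum f (refine X A B \<B>) \<le> sum f (\<B> - {X}) + sum f ({A, B} - {{}})"
    unfolding refine_def using assms by (subst sum_Un) (auto simp: sum_nonneg)
  also have "sum f ({A, B} - {{}}) \<le> sum f {A, B}"
    using assms(3) by (intro sum_mono2) auto
  also have "\<dots> \<le> f A + f B"
    using assms(3)[of A] by (cases "A = B") auto
  finally show ?thesis
    using assms(1,2) by (simp add: sum_diff1)
qed

lemma Union_refine:
  assumes "disjoint \<B>" "X \<in> \<B>" "A \<subseteq> X" "B \<subseteq> X"
  shows "\<Union>(refine X A B \<B>) = (\<Union>\<B> - X) \<union> A \<union> B"
proof -
  have "\<Union>(\<B> - {X}) = \<Union>\<B> - X"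
    using assms(1,2) by (auto simp: disjoint_def)
  then show ?thesis by (auto simp: refine_def)
qed

lemma blocks_rel_refine:
  assumes "disjoint \<B>" "X \<in> \<B>" "A \<subseteq> X" "B \<subseteq> X"
  shows "blocks_rel (refine X A B \<B>) = (blocks_rel \<B> - X \<times> X) \<union> A \<times> A \<union> B \<times> B"
proof -
  have "blocks_rel (\<B> - {X}) = blocks_rel \<B> - X \<times> X"
    using assms(1,2) by (fastforce simp: disjoint_def blocks_rel_def)
  then show ?thesis by (auto simp: refine_def blocks_rel_def)
qed

lemma disjoint_refine:
  assumes "disjoint \<B>" "X \<in> \<B>" "A \<subseteq> X" "B \<subseteq> X" "A \<inter> B = {}"
  shows "disjoint (refine X A B \<B>)"
proof -
  have "disjoint (\<B> - {X})" using assms(1) by (auto simp: disjoint_def)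
  moreover have "disjoint ({A, B} - {{}})" using assms(5) by (auto simp: disjoint_def)
  moreover have "\<Union>(\<B> - {X}) \<inter> \<Union>({A, B} - {{}}) = {}"
    using assms(1-4) by (fastforce simp: disjoint_def)
  ultimately show ?thesis unfolding refine_def by (rule disjoint_union)
qed

text \<open>An end-component avoiding \<open>T\<close> lies wholly in one class of \<open>R\<close>
  or wholly in one block. Only those inside \<open>X\<close> are affected by the step, and
  \<open>split_ok\<close> places them.\<close>

lemma blocks_inv_refine:
  assumes fin: "finite (vertices P)" and inv: "blocks_inv P \<B> T R" and X: "X \<in> \<B>"
    and ok: "split_ok P X A L T' R'"
  shows "blocks_inv P (refine X A (X - A - L) \<B>) (T \<union> T') (R \<union> R')"
    and "block_potential (refine X A (X - A - L) \<B>) < block_potential \<B>"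
proof -
  let ?B = "X - A - L" and ?\<B> = "refine X A (X - A - L) \<B>"
  have inv': "disjoint \<B>" "{} \<notin> \<B>" "\<Union>\<B> \<subseteq> vertices P" "T \<subseteq> vertices P" "\<Union>\<B> \<inter> T = {}"
     "R \<subseteq> ec_rel P (vertices P - T - \<Union>\<B>)" "ec_rel P (vertices P - T) \<subseteq> R \<union> blocks_rel \<B>"
    using inv by (simp_all add: blocks_inv_def)
  have ok': "A \<inter> L = {}" "A \<union> L \<subseteq> X" "T' \<subseteq> L" "L = {} \<Longrightarrow> A \<noteq> {} \<and> A \<noteq> X"
     "R' \<subseteq> ec_rel P (L - T')"
    using ok by (simp_all add: split_ok_def)
  have AX: "A \<subseteq> X" using ok' by auto
  have XV: "X \<subseteq> vertices P" using X inv'(3) by auto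
  have finX: "finite X" using XV fin by (rule finite_subset)
  have finB: "finite \<B>" using inv'(3) fin by (meson finite_UnionD finite_subset)
  have U: "\<Union>?\<B> = (\<Union>\<B> - X) \<union> A \<union> ?B"
    by (rule Union_refine) (use inv' X AX in auto)
  have Q: "blocks_rel ?\<B> = (blocks_rel \<B> - X \<times> X) \<union> A \<times> A \<union> ?B \<times> ?B"
    by (rule blocks_rel_refine) (use inv' X AX in auto)
  have XU: "X \<subseteq> \<Union>\<B>" using X by auto
  have R: "R \<union> R' \<subseteq> ec_rel P (vertices P - (T \<union> T') - \<Union>?\<B>)"
  proof -
    have "ec_rel P (vertices P - T - \<Union>\<B>) \<subseteq> ec_rel P (vertices P - (T \<union> T') - \<Union>?\<B>)"
      by (rule ec_rel_mono) (use U XU ok' in auto)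
    moreover have "ec_rel P (L - T') \<subseteq> ec_rel P (vertices P - (T \<union> T') - \<Union>?\<B>)"
    proof (rule ec_rel_mono)
      have "L \<subseteq> X" "X \<inter> T = {}" using ok'(2) XU inv'(5) by auto
      then show "L - T' \<subseteq> vertices P - (T \<union> T') - \<Union>?\<B>"
        unfolding U using XV ok'(1) by blast
    qed
    ultimately show ?thesis using inv'(6) ok'(5) by auto
  qed
  have cover: "ec_rel P (vertices P - (T \<union> T')) \<subseteq> R \<union> R' \<union> blocks_rel ?\<B>"
  proof
    fix p assume "p \<in> ec_rel P (vertices P - (T \<union> T'))"
    then obtain u v Y where Y: "p = (u, v)" "end_component P Y" "Y \<subseteq> vertices P - (T \<union> T')"
        "u \<in> Y" "v \<in> Y"
      by (cases p) (auto elim: ec_relE)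
    have YY: "(u, y) \<in> R \<union> blocks_rel \<B>" if "y \<in> Y" for y
      using inv'(7) ec_relI[OF Y(2) _ Y(4) that, of "vertices P - T"] Y(3) by auto
    show "p \<in> R \<union> R' \<union> blocks_rel ?\<B>"
    proof (cases "(u, v) \<in> R")
      case False
      then obtain Z where Z: "Z \<in> \<B>" "u \<in> Z" "v \<in> Z"
        using YY[OF Y(5)] by (auto simp: blocks_rel_def)
      \<comment> \<open>As \<open>u\<close> is in a block, it is outside the domain of
        \<open>R\<close>. All pairs from \<open>u\<close> into \<open>Y\<close> therefore come from
        blocks, and by disjointness from \<open>Z\<close>.\<close>
      have "Y \<subseteq> Z"
      proof
        fix y assume "y \<in> Y"
        moreover have "(u, y) \<notin> R"
          using inv'(6) Z ec_rel_subset[of u y P "vertices P - T - \<Union>\<B>"] by auto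
        ultimately show "y \<in> Z"
          using YY Z inv'(1) by (fastforce simp: blocks_rel_def disjoint_def)
      qed
      show ?thesis
      proof (cases "Z = X")
        case True
        then have "Y \<subseteq> A \<or> Y \<subseteq> ?B \<or> Y \<times> Y \<subseteq> R'"
          using ok Y \<open>Y \<subseteq> Z\<close> unfolding split_ok_def by blast
        then show ?thesis unfolding Q Y(1) using Y(4,5) by blast
      next
        case False
        then have "u \<notin> X" using Z(1,2) X inv'(1) by (auto simp: disjoint_def)
        moreover have "(u, v) \<in> blocks_rel \<B>" using Z by (auto simp: blocks_rel_def)
        ultimately show ?thesis unfolding Q Y(1) by blast
      qed
    qed (use Y in auto)
  qed
  have "sqrt (real (card (vertices P))) * real (card (T \<union> T')) + (\<Sum>X\<in>?\<B>. entropy (card X))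
      \<le> sqrt (real (card (vertices P))) * (real (card T) + real (card T')) +
        ((\<Sum>X\<in>\<B>. entropy (card X)) + entropy (card A) + entropy (card ?B) - entropy (card X))"
    using sum_refine_le_real[OF finB X, of "\<lambda>X. entropy (card X)" A ?B] card_Un_le[of T T']
    by (intro add_mono mult_left_mono) (auto simp: entropy_nonneg simp flip: of_nat_add)
  also have "\<dots> \<le> entropy (card (vertices P))"
    using ok inv by (simp add: split_ok_def blocks_inv_def algebra_simps)
  finally have ent: "sqrt (real (card (vertices P))) * real (card (T \<union> T')) +
      (\<Sum>X\<in>?\<B>. entropy (card X)) \<le> entropy (card (vertices P))" .
  show "blocks_inv P ?\<B> (T \<union> T') (R \<union> R')"
    unfolding blocks_inv_def
  proof (intro conjI)
    show "disjoint ?\<B>"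
      by (rule disjoint_refine) (use inv' X AX in auto)
    show "{} \<notin> ?\<B>" using inv'(2) by (simp add: refine_def)
    show "\<Union>?\<B> \<subseteq> vertices P" unfolding U using inv'(3) XV AX by blast
    show "T \<union> T' \<subseteq> vertices P" using inv'(4) ok'(2,3) XV by blast
    show "\<Union>?\<B> \<inter> (T \<union> T') = {}"
      unfolding U using inv'(5) ok'(1,2,3) XU by blast
  qed (fact R cover ent)+
  have "real (block_potential ?\<B>) + real (2 * card X - 1)
      \<le> real (block_potential \<B>) + real (2 * card A - 1) + real (2 * card ?B - 1)"
    unfolding block_potential_def of_nat_sum
    using sum_refine_le_real[OF finB X, of "\<lambda>X. real (2 * card X - 1)" A ?B] by simp
  then have "block_potential ?\<B> + (2 * card X - 1)
      \<le> block_potential \<B> + (2 * card A - 1) + (2 * card ?B - 1)"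
    by (simp flip: of_nat_add)
  \<comment> \<open>If \<open>L\<close> is non-empty its vertices give the decrease. Otherwise both
    parts are non-empty, and subtracting 1 twice gives it.\<close>
  moreover have "(2 * card A - 1) + (2 * card ?B - 1) < 2 * card X - 1"
  proof -
    have fins: "finite A" "finite L" using finX ok' by (auto intro: finite_subset)
    have "X = A \<union> (L \<union> ?B)" using ok' by auto
    then have "card X = card (A \<union> (L \<union> ?B))" by simp
    also have "\<dots> = card A + (card L + card ?B)"
      using fins finX ok'(1) by (subst card_Un_disjoint; (subst card_Un_disjoint)?) auto
    finally have cX: "card X = card A + (card L + card ?B)" .
    have "card X \<noteq> 0" using finX X inv'(2) by auto
    moreover have "card A \<noteq> 0 \<and> card ?B \<noteq> 0" if "card L = 0"
      using that fins ok'(4) AX finX by auto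
    ultimately show ?thesis using cX by linarith
  qed
  ultimately show "block_potential ?\<B> < block_potential \<B>" by linarith
qed

definition leaving_random :: "'v mdp \<Rightarrow> 'v set \<Rightarrow> 'v set" where
  "leaving_random P X = {v. \<exists>w \<in> vertices P - X. (v, w) \<in> edges P} \<inter> X \<inter> random P"

text \<open>An end-component inside \<open>X\<close> containing such a vertex would contain its
  successor outside \<open>X\<close>. These vertices are thus dropped without burdening the
  separator.\<close>

lemma split_ok_leaving_random:
  assumes "finite X" "leaving_random P X \<noteq> {}"
  shows "split_ok P X (X - leaving_random P X) (leaving_random P X) {} {}"
proof -
  have B: "X - (X - leaving_random P X) - leaving_random P X = {}" by auto
  have "Y \<subseteq> X - leaving_random P X" if "end_component P Y" "Y \<subseteq> X" for Y
    using that end_component_random[of P Y] by (fastforce simp: leaving_random_def)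
  \<comment> \<open>Monotonicity of entropy is the splitting inequality with an empty layer and an
    empty second part.\<close>
  moreover have "entropy (card (X - leaving_random P X)) \<le> entropy (card X)"
    using entropy_split_le[of 0 0 "card (X - leaving_random P X)" 0 "card X"] assms(1)
    by (simp add: card_mono)
  ultimately show ?thesis
    unfolding split_ok_def B using assms(2) by (auto simp: leaving_random_def)
qed

text \<open>An end-component meeting both sides has edges across in both directions. One of them
  follows \<open>F\<close> out of \<open>A\<close> and so ends in \<open>L\<close>, whichever
  orientation \<open>F\<close> has.\<close>

lemma end_component_layered:
  assumes "F = edges P \<or> F = (edges P)\<inverse>" "layered F X v A L"
    and Y: "end_component P Y" "Y \<subseteq> X - L"
  shows "Y \<subseteq> A \<or> Y \<subseteq> X - A - L"
proof (rule ccontr)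
  assume "\<not> (Y \<subseteq> A \<or> Y \<subseteq> X - A - L)"
  then have "A \<inter> Y \<noteq> {}" "\<not> Y \<subseteq> A" "(X - A) \<inter> Y \<noteq> {}" "\<not> Y \<subseteq> X - A"
    using Y(2) by auto
  then obtain a b c d where "(a, b) \<in> edges P" "a \<in> A \<inter> Y" "b \<in> Y - A"
      and "(c, d) \<in> edges P" "c \<in> (X - A) \<inter> Y" "d \<in> Y - (X - A)"
    using end_component_edge_out[OF Y(1)] by metis
  then show False
    using assms(1,2) Y(2) by (auto simp: layered_def)
qed

lemma split_ok_layered:
  assumes F: "F = edges P \<or> F = (edges P)\<inverse>" and lay: "layered F X v A L"
    and fin: "finite X" and n: "card (vertices P) \<noteq> 0"
    and less: "card A < card X"
    and thin: "card (vertices P) * (card L)\<^sup>2 \<le> (card A)\<^sup>2"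
      "card (vertices P) * (card L)\<^sup>2 \<le> (card (X - A - L))\<^sup>2"
  shows "split_ok P X A L L {}"
proof -
  let ?n = "card (vertices P)"
  have l: "A \<inter> L = {}" "A \<union> L \<subseteq> X" "v \<in> A \<union> L"
    using lay by (auto simp: layered_def)
  have fins: "finite A" "finite L" using l fin by (auto intro: finite_subset)
  have root: "sqrt (real ?n) * real (card L) \<le> real a" if "?n * (card L)\<^sup>2 \<le> a\<^sup>2" for a
  proof -
    have "real (?n * (card L)\<^sup>2) \<le> real (a\<^sup>2)" using that by (simp only: of_nat_le_iff)
    then have "(sqrt (real ?n) * real (card L))\<^sup>2 \<le> (real a)\<^sup>2"
      by (simp add: power_mult_distrib)
    then show ?thesis by (rule power2_le_imp_le) simp
  qed
  have "card A + card (X - A - L) \<le> card X"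
  proof -
    have "card (A \<union> (X - A - L)) = card A + card (X - A - L)"
      using fins fin by (intro card_Un_disjoint) auto
    moreover have "card (A \<union> (X - A - L)) \<le> card X"
      using fin l by (intro card_mono) auto
    ultimately show ?thesis by simp
  qed
  then have "sqrt (real ?n) * real (card L) + entropy (card A) + entropy (card (X - A - L))
      \<le> entropy (card X)"
    by (intro entropy_split_le root thin)
  \<comment> \<open>If \<open>A\<close> were empty, thinness would make \<open>L\<close> empty too,
    but \<open>v\<close> lies in one of them.\<close>
  moreover have "A \<noteq> {}"
    using thin(1) n l fins by auto
  moreover have "A \<noteq> X" using less by auto
  ultimately show ?thesis
    using l end_component_layered[OF F lay] by (auto simp: split_ok_def)
qed

text \<open>Both searches from \<open>v\<close> passed the whole block, so it is strongly connected,
  and no random vertex leaves it. Taking \<open>L = X\<close> and an empty \<open>T\<close> retires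
  the block without enlarging the separator.\<close>

lemma split_ok_end_component:
  assumes X: "X \<subseteq> vertices P" "X \<noteq> {}" and closed: "leaving_random P X = {}"
    and E: "edges P \<subseteq> vertices P \<times> vertices P"
    and lay: "layered (edges P) X v X {}" "layered ((edges P)\<inverse>) X v X {}"
  shows "split_ok P X {} X {} (X \<times> X)"
proof -
  have v: "v \<in> X" using lay(1) by (simp add: layered_def)
  have conv: "((edges P)\<inverse> \<inter> X \<times> X)\<^sup>* = ((edges P \<inter> X \<times> X)\<^sup>*)\<inverse>"
    by (subst rtrancl_converse[symmetric]) (simp add: converse_Int converse_Times)
  have "end_component P X"
    unfolding end_component_def
  proof (intro conjI)
    show "strongly_connected_on (edges P) X"
      by (rule strongly_connected_onI[OF v])
        (use layered_reach[OF lay(1)] layered_reach[OF lay(2)] conv in auto)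
    show "\<forall>v\<in>X \<inter> random P. \<forall>u. (v, u) \<in> edges P \<longrightarrow> u \<in> X"
      using closed E by (auto simp: leaving_random_def)
  qed (fact X)
  then have "X \<times> X \<subseteq> ec_rel P X"
    by (auto intro: ec_relI)
  then show ?thesis
    using X(2) entropy_nonneg[of "card X"] by (auto simp: split_ok_def)
qed

definition search_bound :: "nat \<Rightarrow> real" where
  "search_bound n = 2 * (sqrt (real n) + 2) * ln (real n + 1)"

lemma search_bound_nonneg: "0 \<le> search_bound n"
  by (simp add: search_bound_def)

text \<open>The inequality \<open>ln y \<le> y - 1\<close> at the reciprocal of
  \<open>1 + 1 / (r + 1)\<close> bounds the gain of each round below by
  \<open>1 / (r + 2)\<close>.\<close>

lemma search_steps_le:
  assumes "search_steps n x k" "x \<le> n"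
  shows "real k \<le> search_bound n"
proof -
  define r where "r = sqrt (real n)"
  have r: "0 \<le> r" by (simp add: r_def)
  have "1 / (r + 2) = - (1 / (1 + 1 / (r + 1)) - 1)"
    using r by (simp add: field_simps)
  also have "\<dots> \<le> - ln (1 / (1 + 1 / (r + 1)))"
    using r by (intro le_imp_neg_le ln_le_minus_one) (simp add: add_pos_nonneg)
  also have "\<dots> = ln (1 + 1 / (r + 1))"
    using r by (subst ln_div) (auto simp: add_pos_nonneg)
  finally have "real k * (1 / (r + 2)) \<le> real k * ln (1 + 1 / (r + 1))"
    by (intro mult_left_mono) auto
  also have "\<dots> \<le> 2 * ln (real x + 1)"
    using assms(1) by (simp add: search_steps_def r_def)
  also have "\<dots> \<le> 2 * ln (real n + 1)"
    using assms(2) by simp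
  finally show ?thesis
    using r by (simp add: search_bound_def divide_le_eq r_def[symmetric] algebra_simps)
qed

section \<open>The three phases of the program\<close>

definition input_regs :: "'v mdp \<Rightarrow> nat \<Rightarrow> 'v state \<Rightarrow> bool" where
  "input_regs P N s \<longleftrightarrow> store s 0 = Some (VSet (vertices P)) \<and> store s 1 = Some (ESet (edges P)) \<and>
     store s 3 = Some (VSet (random P)) \<and> store s 4 = Some (VSet {}) \<and> mem s 1 = N \<and> reported s = []"

lemma input_regs_same_except:
  assumes "same_except rs ms s t" "{0, 1, 3, 4} \<inter> rs = {}" "1 \<notin> ms"
  shows "input_regs P N t \<longleftrightarrow> input_regs P N s"
  using assms by (auto simp: same_except_def input_regs_def)

lemma setop_result_Post: "setop_result Post (ESet F) (VSet S) = Some (VSet (F `` S))"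
  by auto

lemma setop_result_Pre: "setop_result Pre (ESet F) (VSet S) = Some (VSet (F\<inverse> `` S))"
  by auto

section \<open>First phase: a separator by refinement of blocks\<close>

definition finish_block :: com where
  "finish_block =
     set_op 15 Cross 10 10 ;; set_op 8 Cup 8 15 ;; set_op 11 Cup 4 4 ;; set_op 12 Cup 10 10"

definition backward_search :: com where
  "backward_search =
     search Pre ;; set_op 7 Cup 7 12 ;; If (Less (var 3) (var 2)) Skip finish_block"

text \<open>The layer may join the separator before the test: if the search has passed the whole
  block, the layer is empty.\<close>

definition forward_search :: com where
  "forward_search =
     search Post ;; set_op 7 Cup 7 12 ;; If (Less (var 3) (var 2)) Skip backward_search"

definition split_block :: com where
  "split_block =
     set_op 14 Setminus 0 10 ;; set_op 14 Pre 1 14 ;; set_op 14 Cap 14 10 ;; set_op 12 Cap 14 3 ;;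
     Test (Const 6) Equal (Const 12) (Const 4) ;;
     If (var 6) forward_search (set_op 11 Setminus 10 12)"

lemma layered_full:
  assumes "layered F X v A L" "finite X" "\<not> card A < card X"
  shows "A = X" "L = {}"
proof -
  have "A \<subseteq> X" "A \<inter> L = {}" "L \<subseteq> X" using assms(1) by (auto simp: layered_def)
  then show "A = X" using assms(2,3) by (meson card_subset_eq card_mono le_neq_implies_less)
  then show "L = {}" using \<open>A \<inter> L = {}\<close> \<open>L \<subseteq> X\<close> by auto
qed

text \<open>Every outcome is delivered in cells 11 and 12, so the code that follows needs no case
  distinction. The constant 17 is 5 for the test of random vertices, 4 for each of the two searches
  with its update of the separator, and 4 for \<open>finish_block\<close>.\<close>

lemma runs_split_block:
  assumes mdp: "is_mdp P" and input: "input_regs P (card (vertices P)) s"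
    and regs: "store s 7 = Some (VSet T)" "store s 8 = Some (ESet R)"
      "store s 9 = Some (VSet {v})" "store s 10 = Some (VSet X)"
    and v: "v \<in> X" and X: "X \<subseteq> vertices P"
    and Q: "\<And>t A L T' R'. \<lbrakk>split_ok P X A L T' R';
      same_except {7, 8, 11, 12, 14, 15} {2, 3, 4, 6} s t;
      store t 7 = Some (VSet (T \<union> T')); store t 8 = Some (ESet (R \<union> R'));
      store t 11 = Some (VSet A); store t 12 = Some (VSet L);
      real (num_ops t) \<le> real (num_ops s) + 17 + 12 * search_bound (card (vertices P))\<rbrakk> \<Longrightarrow> Q t"
  shows "runs pk split_block s Q"
proof -
  let ?n = "card (vertices P)"
  have finV: "finite (vertices P)" using mdp by (simp add: is_mdp_def)
  have finX: "finite X" using X finV by (rule finite_subset)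
  have cX: "card X \<le> ?n" using X finV by (simp add: card_mono)
  have n: "?n \<noteq> 0" using v X finV by auto
  have E: "edges P \<subseteq> vertices P \<times> vertices P" using mdp by (simp add: is_mdp_def)
  have sb: "0 \<le> search_bound ?n" by (rule search_bound_nonneg)
  have leaving: "(edges P)\<inverse> `` (vertices P - X) \<inter> X \<inter> random P = leaving_random P X"
    by (auto simp: leaving_random_def)
  define s1 where "s1 = put_answer 6 (of_bool (leaving_random P X = {}))
    (put_set 12 (VSet (leaving_random P X)) (put_set 14 (VSet ((edges P)\<inverse> `` (vertices P - X) \<inter> X))
    (put_set 14 (VSet ((edges P)\<inverse> `` (vertices P - X))) (put_set 14 (VSet (vertices P - X)) s))))"
  have s1: "input_regs P ?n s1" "same_except {12, 14} {6} s s1" "num_ops s1 = num_ops s + 5"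
      "store s1 12 = Some (VSet (leaving_random P X))"
    using input by (simp_all add: s1_def same_except_def input_regs_def)
  have s1_regs: "store s1 7 = Some (VSet T)" "store s1 8 = Some (ESet R)"
      "store s1 9 = Some (VSet {v})" "store s1 10 = Some (VSet X)"
    using regs by (simp_all add: s1_def)
  have *: "runs pk (If (var 6) forward_search (set_op 11 Setminus 10 12)) s1 Q"
  proof (cases "leaving_random P X = {}")
    case False
    have "mem s1 6 = 0" using False by (simp add: s1_def)
    then show ?thesis
      using s1_regs s1(4)
      apply simp
      apply (rule Q[OF split_ok_leaving_random[OF finX False]])
      using s1 s1_regs sb by (auto simp: same_except_def)
  next
    case True
    have m6: "mem s1 6 = 1" using True by (simp add: s1_def)
    show ?thesis
      apply (simp add: m6 forward_search_def)
      apply (rule runs_search[where E = "edges P" and F = "edges P" and v = v and X = X,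
            OF _ _ s1_regs(3,4) v finX setop_result_Post])
        apply (use s1(1) in \<open>simp add: input_regs_def\<close>)
       apply (use s1(1) in \<open>simp add: input_regs_def\<close>)
      subgoal premises prems for t A L k
      proof -
        have mem1: "mem s1 1 = ?n" using s1(1) by (simp add: input_regs_def)
        have t7: "store t 7 = Some (VSet T)" using prems(1) s1_regs by (simp add: same_except_def)
        define t1 where "t1 = put_set 7 (VSet (T \<union> L)) t"
        have k: "real k \<le> search_bound ?n"
          using prems(10) mem1 cX search_steps_le by metis
        have same1: "same_except {7, 11, 12, 14} {2, 3, 4} s1 t1"
          using prems(1) by (auto simp: same_except_def t1_def)
        show ?thesis
        proof (cases "card A < card X")
          case less: True
          have "Q t1"
            by (rule Q[OF split_ok_layered[OF _ prems(6) finX n less]])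
              (use prems mem1 s1 s1_regs k sb in \<open>auto simp: same_except_def t1_def\<close>)
          then show ?thesis
            using less prems(3,4,5) t7 by (simp add: t1_def)
        next
          case full: False
          note AL = layered_full[OF prems(6) finX full]
          have t1_regs: "store t1 7 = Some (VSet T)" "store t1 8 = Some (ESet R)"
              "store t1 9 = Some (VSet {v})" "store t1 10 = Some (VSet X)"
              "store t1 1 = Some (ESet (edges P))" "store t1 4 = Some (VSet {})" "mem t1 1 = ?n"
            using same1 AL s1_regs s1(1) by (auto simp: same_except_def t1_def input_regs_def)
          have "runs pk backward_search t1 Q"
            apply (simp add: backward_search_def)
            apply (rule runs_search[where E = "edges P" and F = "(edges P)\<inverse>" and v = v and X = X,
                  OF t1_regs(5,6,3,4) v finX setop_result_Pre])
            subgoal premises prems2 for u A' L' k'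
            proof -
              have u7: "store u 7 = Some (VSet T)" using prems2(1) t1_regs by (simp add: same_except_def)
              define u1 where "u1 = put_set 7 (VSet (T \<union> L')) u"
              have k': "real k' \<le> search_bound ?n"
                using prems2(10) t1_regs(7) cX search_steps_le by metis
              have same2: "same_except {7, 11, 12, 14} {2, 3, 4} s1 u1"
                using same1 prems2(1) by (auto simp: same_except_def u1_def t1_def)
              have ops: "num_ops u1 = num_ops s + 13 + 6 * k + 6 * k'"
                using prems(9) prems2(9) s1(3) by (simp add: u1_def t1_def)
              show ?thesis
              proof (cases "card A' < card X")
                case less: True
                have "Q u1"
                  by (rule Q[OF split_ok_layered[OF _ prems2(6) finX n less]])
                    (use prems2 t1_regs(7) s1 s1_regs same2 ops k k' in \<open>auto simp: same_except_def u1_def\<close>)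
                then show ?thesis
                  using less prems2(3,4,5) u7 by (simp add: u1_def)
              next
                case full': False
                note AL' = layered_full[OF prems2(6) finX full']
                have u1_regs: "store u1 7 = Some (VSet T)" "store u1 8 = Some (ESet R)"
                    "store u1 10 = Some (VSet X)" "store u1 4 = Some (VSet {})"
                  using same2 AL' s1_regs s1(1) by (auto simp: same_except_def u1_def input_regs_def)
                have "split_ok P X {} X {} (X \<times> X)"
                  by (rule split_ok_end_component[OF X _ True E])
                    (use v prems(6) prems2(6) AL AL' in auto)
                then have "runs pk finish_block u1 Q"
                  using u1_regs
                  apply (simp add: finish_block_def)
                  apply (erule Q)
                  using same2 s1 ops k k' by (auto simp: same_except_def)
                then show ?thesis
                  using full' prems2(3,4,5) u7 by (simp add: u1_def)
              qed
            qed
            done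
          then show ?thesis
            using full prems(3,4,5) t7 by (simp add: t1_def)
        qed
      qed
      done
  qed
  show ?thesis
    unfolding split_block_def
    using input regs * leaving
    by (simp add: input_regs_def s1_def setop_result_Pre del: setop_result.simps(8) runs_simps(8) One_nat_def)
qed

definition replace_block :: com where
  "replace_block =
     set_op 13 Setminus 10 11 ;; set_op 13 Setminus 13 12 ;;
     set_op 5 Setminus 5 10 ;; set_op 5 Cup 5 11 ;; set_op 5 Cup 5 13 ;;
     set_op 15 Cross 10 10 ;; set_op 6 Setminus 6 15 ;;
     set_op 15 Cross 11 11 ;; set_op 6 Cup 6 15 ;;
     set_op 15 Cross 13 13 ;; set_op 6 Cup 6 15 ;;
     Test (Const 5) Equal (Const 5) (Const 4)"

definition refine_step :: com where
  "refine_step =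
     Pick (Const 9) (Const 5) ;; set_op 10 Post 6 9 ;; split_block ;; replace_block"

definition separate :: com where
  "separate =
     set_op 4 Setminus 0 0 ;; Card (Const 1) (Const 0) ;; set_op 5 Cup 0 0 ;; set_op 6 Cross 0 0 ;;
     set_op 7 Cup 4 4 ;; set_op 8 Cross 4 4 ;; Test (Const 5) Equal (Const 5) (Const 4) ;;
     While (Eq (var 5) (Const 0)) refine_step"

text \<open>The constant is 2 for choosing a block, 17 from \<open>split_block\<close> and 12 for
  \<open>replace_block\<close>.\<close>

definition refine_cost :: "nat \<Rightarrow> real" where
  "refine_cost n = 31 + 12 * search_bound n"

text \<open>The last clause is an amortised budget: 7 operations before the loop, then
  \<open>refine_cost\<close> for each unit of a potential that starts at no more than
  \<open>2 * n\<close>.\<close>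

definition refining ::
    "'v mdp \<Rightarrow> 'v set set \<times> 'v set \<times> ('v \<times> 'v) set \<Rightarrow> 'v state \<Rightarrow> bool" where
  "refining P = (\<lambda>(\<B>, T, R) s. input_regs P (card (vertices P)) s \<and>
     store s 5 = Some (VSet (\<Union>\<B>)) \<and> store s 6 = Some (ESet (blocks_rel \<B>)) \<and>
     store s 7 = Some (VSet T) \<and> store s 8 = Some (ESet R) \<and> mem s 5 = of_bool (\<Union>\<B> = {}) \<and>
     blocks_inv P \<B> T R \<and>
     real (num_ops s) + refine_cost (card (vertices P)) * real (block_potential \<B>)
       \<le> 7 + refine_cost (card (vertices P)) * (2 * real (card (vertices P))))"

lemma runs_refine_step:
  assumes pk: "valid_picker pk" and mdp: "is_mdp P" and inv: "refining P (\<B>, T, R) s"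
    and m5: "mem s 5 = 0"
  shows "runs pk refine_step s (\<lambda>t. \<exists>g. refining P g t \<and>
    (\<lambda>(\<B>, T, R). block_potential \<B>) g < block_potential \<B>)"
proof -
  let ?n = "card (vertices P)" and ?K = "refine_cost (card (vertices P))"
  have finV: "finite (vertices P)" using mdp by (simp add: is_mdp_def)
  have inv': "input_regs P ?n s" "store s 5 = Some (VSet (\<Union>\<B>))"
     "store s 6 = Some (ESet (blocks_rel \<B>))" "store s 7 = Some (VSet T)" "store s 8 = Some (ESet R)"
     "blocks_inv P \<B> T R"
     "real (num_ops s) + ?K * real (block_potential \<B>) \<le> 7 + ?K * (2 * real ?n)"
    and ne: "\<Union>\<B> \<noteq> {}"
    using inv m5 by (simp_all add: refining_def)
  have K: "0 \<le> ?K" using search_bound_nonneg[of ?n] by (simp add: refine_cost_def)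
  show ?thesis
    unfolding refine_step_def
  proof (subst runs_simps(7), rule runs_Pick[OF pk _ ne])
    show "store s (aval (Const 5) (mem s)) = Some (VSet (\<Union>\<B>))" using inv' by simp
    fix v assume v: "v \<in> \<Union>\<B>"
    then obtain X where X: "X \<in> \<B>" "v \<in> X" by auto
    have dis: "disjoint \<B>" and sub: "\<Union>\<B> \<subseteq> vertices P"
      using inv'(6) by (simp_all add: blocks_inv_def)
    have XV: "X \<subseteq> vertices P" using X sub by auto
    have block: "blocks_rel \<B> `` {v} = X"
      using X dis by (fastforce simp: blocks_rel_def disjoint_def)
    define s1 where "s1 = put_set 10 (VSet X) (put_set 9 (VSet {v}) s)"
    have s1: "input_regs P ?n s1" "store s1 7 = Some (VSet T)" "store s1 8 = Some (ESet R)"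
      "store s1 9 = Some (VSet {v})" "store s1 10 = Some (VSet X)"
      "store s1 5 = Some (VSet (\<Union>\<B>))" "store s1 6 = Some (ESet (blocks_rel \<B>))"
      "num_ops s1 = num_ops s + 2"
      using inv' by (simp_all add: s1_def input_regs_def)
    have "runs pk split_block s1 (\<lambda>t. runs pk replace_block t (\<lambda>t. \<exists>g. refining P g t \<and>
        (\<lambda>(\<B>, T, R). block_potential \<B>) g < block_potential \<B>))"
    proof (rule runs_split_block[OF mdp s1(1-5) X(2) XV], goal_cases)
      case (1 t A L T' R')
      let ?B = "X - A - L" and ?\<B> = "refine X A (X - A - L) \<B>"
      have A: "A \<subseteq> X" using 1(1) by (simp add: split_ok_def)
      have U: "\<Union>?\<B> = \<Union>\<B> - X \<union> A \<union> ?B"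
        using dis X(1) A by (rule Union_refine) auto
      have Q: "blocks_rel ?\<B> = blocks_rel \<B> - X \<times> X \<union> A \<times> A \<union> ?B \<times> ?B"
        using dis X(1) A by (rule blocks_rel_refine) auto
      note inv2 = blocks_inv_refine[OF finV inv'(6) X(1) 1(1)]
      have t: "input_regs P ?n t" "store t 5 = Some (VSet (\<Union>\<B>))"
          "store t 6 = Some (ESet (blocks_rel \<B>))" "store t 10 = Some (VSet X)"
        using s1 1(2) input_regs_same_except[OF 1(2)] by (auto simp: same_except_def)
      have "real (block_potential ?\<B>) + 1 \<le> real (block_potential \<B>)"
        using inv2(2) by linarith
      then have "?K * (real (block_potential ?\<B>) + 1) \<le> ?K * real (block_potential \<B>)"
        using K by (rule mult_left_mono)
      \<comment> \<open>The 12 reserves the cost of \<open>replace_block\<close>, which is still to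
        run.\<close>
      then have ops: "real (num_ops t) + 12 + ?K * real (block_potential ?\<B>) \<le> 7 + ?K * (2 * real ?n)"
        using inv'(7) 1(7) s1(8) by (simp add: algebra_simps refine_cost_def)
      define t' where "t' = put_answer 5 (of_bool (\<Union>?\<B> = {})) (put_set 6 (ESet (blocks_rel ?\<B>))
        (put_set 15 (ESet (?B \<times> ?B)) (put_set 6 (ESet (blocks_rel \<B> - X \<times> X \<union> A \<times> A))
        (put_set 15 (ESet (A \<times> A)) (put_set 6 (ESet (blocks_rel \<B> - X \<times> X))
        (put_set 15 (ESet (X \<times> X)) (put_set 5 (VSet (\<Union>?\<B>)) (put_set 5 (VSet (\<Union>\<B> - X \<union> A))
        (put_set 5 (VSet (\<Union>\<B> - X)) (put_set 13 (VSet ?B) (put_set 13 (VSet (X - A)) t)))))))))))"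
      have "refining P (?\<B>, T \<union> T', R \<union> R') t'"
        unfolding refining_def prod.case
      proof (intro conjI)
        show "input_regs P ?n t'" using t(1) by (simp add: t'_def input_regs_def)
      qed (use 1 inv2(1) ops in \<open>simp_all add: t'_def\<close>)
      then have "\<exists>g. refining P g t' \<and>
        (\<lambda>(\<B>, T, R). block_potential \<B>) g < block_potential \<B>"
        using inv2(2) by (intro exI[of _ "(?\<B>, T \<union> T', R \<union> R')"]) simp
      then show ?case
        using t 1 unfolding replace_block_def t'_def U Q by (simp add: input_regs_def del: Union_iff)
    qed
    then show "runs pk (set_op 10 Post 6 9 ;; split_block ;; replace_block)
        (put_set (aval (Const 9) (mem s)) (VSet {v}) s)
        (\<lambda>t. \<exists>g. refining P g t \<and> (\<lambda>(\<B>, T, R). block_potential \<B>) g < block_potential \<B>)"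
      using inv'(3) by (simp add: s1_def block setop_result_Post del: setop_result.simps(9))
  qed
qed

lemma runs_separate:
  assumes pk: "valid_picker pk" and mdp: "is_mdp P"
    and s: "store s 0 = Some (VSet (vertices P))" "store s 1 = Some (ESet (edges P))"
      "store s 3 = Some (VSet (random P))" "reported s = []" "num_ops s = 0"
    and Q: "\<And>t T. \<lbrakk>input_regs P (card (vertices P)) t; store t 7 = Some (VSet T);
      store t 8 = Some (ESet (ec_rel P (vertices P - T))); T \<subseteq> vertices P;
      sqrt (real (card (vertices P))) * real (card T) \<le> entropy (card (vertices P));
      real (num_ops t) \<le> 7 + refine_cost (card (vertices P)) * (2 * real (card (vertices P)))\<rbrakk> \<Longrightarrow> Q t"
  shows "runs pk separate s Q"
proof -
  \<comment> \<open>Removing the empty set makes the initial family correct for an MDP without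
    vertices.\<close>
  let ?n = "card (vertices P)" and ?\<B> = "{vertices P} - {{}}"
  have finV: "finite (vertices P)" using mdp by (simp add: is_mdp_def)
  have Union: "\<Union>?\<B> = vertices P" by auto
  have rel: "blocks_rel ?\<B> = vertices P \<times> vertices P" by (auto simp: blocks_rel_def)
  have blocks: "blocks_inv P ?\<B> {} {}"
    by (cases "vertices P = {}")
      (auto simp: blocks_inv_def blocks_rel_def disjoint_def entropy_nonneg dest: ec_rel_subset)
  have pot: "block_potential ?\<B> \<le> 2 * ?n"
    using finV by (cases "vertices P = {}") (auto simp: block_potential_def)
  have K: "0 \<le> refine_cost ?n" using search_bound_nonneg[of ?n] by (simp add: refine_cost_def)
  have "refine_cost ?n * real (block_potential ?\<B>) \<le> refine_cost ?n * real (2 * ?n)"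
    using pot K by (intro mult_left_mono) (simp_all only: of_nat_le_iff)
  then have ops: "7 + refine_cost ?n * real (block_potential ?\<B>) \<le> 7 + refine_cost ?n * (2 * real ?n)"
    by simp
  have loop: "runs pk (While (Eq (var 5) (Const 0)) refine_step) t Q"
    if init: "refining P (?\<B>, {}, {}) t" for t
  proof (rule runs_While[where I = "refining P" and f = "\<lambda>(\<B>, T, R). block_potential \<B>", OF init],
      goal_cases)
    case (1 g t)
    then show ?case
      by (cases g) (use runs_refine_step[OF pk mdp] in \<open>auto split: if_splits\<close>)
  next
    case (2 g t)
    obtain \<B> T R where g: "g = (\<B>, T, R)" by (cases g)
    have inv: "input_regs P ?n t" "store t 7 = Some (VSet T)" "store t 8 = Some (ESet R)"
        "blocks_inv P \<B> T R" and empty: "\<Union>\<B> = {}"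
        and cost: "real (num_ops t) + refine_cost ?n * real (block_potential \<B>) \<le> 7 + refine_cost ?n * (2 * real ?n)"
      using 2 unfolding g by (auto simp: refining_def split: if_splits)
    have "\<B> = {}" using empty inv(4) by (auto simp: blocks_inv_def)
    then have "R = ec_rel P (vertices P - T)" and T: "T \<subseteq> vertices P" "sqrt (real ?n) * real (card T) \<le> entropy ?n"
      using inv(4) by (auto simp: blocks_inv_def blocks_rel_def)
    moreover have "0 \<le> refine_cost ?n * real (block_potential \<B>)" using K by simp
    ultimately show ?case
      using inv cost T by (intro Q[of t T]) auto
  qed
  show ?thesis
    unfolding separate_def
    using s
    apply (simp del: One_nat_def)
    apply (intro conjI impI; rule loop)
    using blocks ops Union rel
     apply (simp_all add: refining_def input_regs_def del: One_nat_def)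
    done
qed


section \<open>Second phase: putting back the separator vertices\<close>

definition trim_step :: com where
  "trim_step =
     set_op 14 Setminus 0 10 ;; set_op 14 Pre 1 14 ;; set_op 14 Cap 14 10 ;;
     set_op 14 Setminus 14 9 ;; set_op 14 Setminus 14 16 ;;
     set_op 15 Pre 17 10 ;; set_op 15 Pre 8 15 ;; set_op 13 Cap 10 16 ;; set_op 13 Setminus 13 15 ;;
     set_op 14 Cup 14 13 ;; set_op 10 Setminus 10 14 ;; Test (Const 5) Equal (Const 14) (Const 4)"

text \<open>Each round costs 12 operations and removes a vertex, except for the last, which only
  detects stability. The truth value in the budget pays for that last round.\<close>

definition trimming ::
    "'v mdp \<Rightarrow> 'v set \<Rightarrow> 'v \<Rightarrow> 'v state \<Rightarrow> nat \<Rightarrow> 'v set \<times> bool \<Rightarrow> 'v state \<Rightarrow> bool" where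
  "trimming P U v s c = (\<lambda>(S, stable) t. same_except {10, 13, 14, 15} {5} s t \<and>
     store t 10 = Some (VSet S) \<and> mem t 5 = of_bool stable \<and> trim_inv P U v S \<and>
     (stable \<longrightarrow> untrimmed P (ec_rel P U) v S = {}) \<and>
     num_ops t + 12 * (card S + of_bool (\<not> stable)) \<le> c)"

lemma runs_trim:
  assumes va: "vertex_addition P U v" and input: "input_regs P N s" and m5: "mem s 5 = 0"
    and regs: "store s 8 = Some (ESet (ec_rel P U))" "store s 9 = Some (VSet {v})"
      "store s 10 = Some (VSet (insert v U))" "store s 16 = Some (VSet (Domain (ec_rel P U)))"
      "store s 17 = Some (ESet (edges P - ec_rel P U))"
    and Q: "\<And>t S. \<lbrakk>same_except {10, 13, 14, 15} {5} s t; store t 10 = Some (VSet S);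
      trim_inv P U v S; untrimmed P (ec_rel P U) v S = {};
      num_ops t \<le> num_ops s + 12 * (card (insert v U) + 1)\<rbrakk> \<Longrightarrow> Q t"
  shows "runs pk (While (Eq (var 5) (Const 0)) trim_step) s Q"
proof -
  interpret vertex_addition P U v by fact
  have finV: "finite (vertices P)" using mdp by (simp add: is_mdp_def)
  define c where "c = num_ops s + 12 * (card (insert v U) + 1)"
  have init: "trimming P U v s c (insert v U, False) s"
    using trim_inv_init m5 regs by (simp add: trimming_def same_except_def c_def)
  show ?thesis
  proof (rule runs_While[where I = "trimming P U v s c" and
        f = "\<lambda>(S, stable). card S + of_bool (\<not> stable)", OF init], goal_cases)
    case (1 g u)
    then obtain S where inv: "trimming P U v s c (S, False) u" and g: "g = (S, False)"
      by (cases g) (auto simp: trimming_def split: if_splits)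
    let ?D = "untrimmed P (ec_rel P U) v S"
    have u: "same_except {10, 13, 14, 15} {5} s u" "store u 10 = Some (VSet S)" "trim_inv P U v S"
        "num_ops u + 12 * (card S + 1) \<le> c"
      using inv by (simp_all add: trimming_def)
    have u_regs: "store u 0 = Some (VSet (vertices P))" "store u 1 = Some (ESet (edges P))"
        "store u 4 = Some (VSet {})" "store u 8 = Some (ESet (ec_rel P U))" "store u 9 = Some (VSet {v})"
        "store u 16 = Some (VSet (Domain (ec_rel P U)))"
        "store u 17 = Some (ESet (edges P - ec_rel P U))"
      using u(1) input regs by (simp_all add: same_except_def input_regs_def)
    have "finite S"
      using u(3) U t(1) finV by (meson finite_subset insert_subset trim_inv_def)
    have D: "?D \<subseteq> S" by (rule untrimmed_subset)
    have card: "card (S - ?D) + of_bool (?D \<noteq> {}) < card S + 1"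
    proof (cases "?D = {}")
      case False
      then have "S - ?D \<subset> S" using D by auto
      then have "card (S - ?D) < card S"
        using \<open>finite S\<close> by (intro psubset_card_mono)
      then show ?thesis by simp
    qed simp
    have stable: "untrimmed P (ec_rel P U) v (S - ?D) = {}" if "?D = {}"
      using that by simp
    define u' where "u' = put_answer 5 (of_bool (?D = {})) (put_set 10 (VSet (S - ?D)) (put_set 14 (VSet ?D)
      (put_set 13 (VSet (S \<inter> Domain R - R\<inverse> `` (edges P - R)\<inverse> `` S)) (put_set 13 (VSet (S \<inter> Domain R))
      (put_set 15 (VSet (R\<inverse> `` (edges P - R)\<inverse> `` S)) (put_set 15 (VSet ((edges P - R)\<inverse> `` S))
      (put_set 14 (VSet ((edges P)\<inverse> `` (vertices P - S) \<inter> S - {v} - Domain R))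
      (put_set 14 (VSet ((edges P)\<inverse> `` (vertices P - S) \<inter> S - {v}))
      (put_set 14 (VSet ((edges P)\<inverse> `` (vertices P - S) \<inter> S))
      (put_set 14 (VSet ((edges P)\<inverse> `` (vertices P - S))) (put_set 14 (VSet (vertices P - S)) u)))))))))))"
    have "same_except {10, 13, 14, 15} {5} s u'"
      using u(1) by (simp add: u'_def same_except_def)
    then have "trimming P U v s c (S - ?D, ?D = {}) u'"
      unfolding trimming_def prod.case
      using u trim_inv_step[OF u(3)] stable card by (auto simp: u'_def)
    then have "\<exists>g. trimming P U v s c g u' \<and>
        (\<lambda>(S, stable). card S + of_bool (\<not> stable)) g < card S + 1"
      using card by (intro exI[of _ "(S - ?D, ?D = {})"]) simp
    then show ?case
      unfolding g trim_step_def u'_def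
      using u_regs u(2)
      by (simp add: setop_result_Pre untrimmed_def[symmetric]
          del: setop_result.simps(8) split_paired_Ex One_nat_def)
  next
    case (2 g u)
    then obtain S where "g = (S, True)" "trimming P U v s c (S, True) u"
      by (cases g) (auto simp: trimming_def split: if_splits)
    then show ?case
      by (intro Q[of u S]) (auto simp: trimming_def c_def)
  qed
qed

definition grow_component :: com where
  "grow_component = search Post ;; set_op 15 Cross 11 11 ;; set_op 8 Cup 8 15"

definition extend_step :: com where
  "extend_step =
     Pick (Const 9) (Const 7) ;; set_op 7 Setminus 7 9 ;; set_op 10 Setminus 0 7 ;;
     set_op 16 Pre 8 0 ;; set_op 17 Setminus 1 8 ;; Store (Const 5) (Const 0) ;;
     While (Eq (var 5) (Const 0)) trim_step ;;
     set_op 14 Setminus 0 10 ;; set_op 14 Pre 1 14 ;; set_op 14 Cap 14 9 ;; set_op 14 Cap 14 3 ;;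
     Test (Const 5) Equal (Const 14) (Const 4) ;;
     If (var 5) grow_component Skip ;;
     Test (Const 5) Equal (Const 7) (Const 4)"

definition extend :: com where
  "extend =
     Store (Const 1) (Add (Mul (var 1) (var 1)) (Const 1)) ;;
     Test (Const 5) Equal (Const 7) (Const 4) ;;
     While (Eq (var 5) (Const 0)) extend_step"

text \<open>Trimming takes at most \<open>12 * (n + 1)\<close> operations and the search with its
  update \<open>6 * n + 5\<close>. The remaining 11 are 5 for the preparation, 5 for testing the
  edges of the new vertex and 1 for the loop test.\<close>

definition extend_cost :: "nat \<Rightarrow> nat" where
  "extend_cost n = 18 * n + 28"

definition extending :: "'v mdp \<Rightarrow> nat \<Rightarrow> 'v set \<Rightarrow> 'v state \<Rightarrow> bool" where
  "extending P c T s \<longleftrightarrow> input_regs P ((card (vertices P))\<^sup>2 + 1) s \<and>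
     store s 7 = Some (VSet T) \<and> store s 8 = Some (ESet (ec_rel P (vertices P - T))) \<and>
     T \<subseteq> vertices P \<and> mem s 5 = of_bool (T = {}) \<and>
     num_ops s + extend_cost (card (vertices P)) * card T \<le> c"

lemma Pre_vertices_ec_rel: "(ec_rel P U)\<inverse> `` vertices P = Domain (ec_rel P U)"
  by (auto dest: ec_rel_subset)

lemma runs_grow_component:
  assumes mdp: "is_mdp P" and input: "input_regs P ((card (vertices P))\<^sup>2 + 1) s"
    and regs: "store s 8 = Some (ESet R)" "store s 9 = Some (VSet {v})" "store s 10 = Some (VSet S)"
    and v: "v \<in> S" and S: "S \<subseteq> vertices P"
    and A: "A = (edges P \<inter> S \<times> S)\<^sup>* `` {v}"
    and Q: "\<And>t. \<lbrakk>same_except {8, 11, 12, 14, 15} {2, 3, 4} s t; store t 8 = Some (ESet (R \<union> A \<times> A));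
      num_ops t \<le> num_ops s + 6 * card (vertices P) + 5\<rbrakk> \<Longrightarrow> Q t"
  shows "runs pk grow_component s Q"
proof -
  let ?n = "card (vertices P)"
  have finV: "finite (vertices P)" using mdp by (simp add: is_mdp_def)
  have finS: "finite S" using S finV by (rule finite_subset)
  have s: "store s 1 = Some (ESet (edges P))" "store s 4 = Some (VSet {})"
    using input by (simp_all add: input_regs_def)
  have mem1: "mem s 1 = ?n\<^sup>2 + 1" using input by (simp add: input_regs_def)
  show ?thesis
    unfolding grow_component_def runs_simps(7)
  proof (rule runs_search[OF s regs(2,3) v finS setop_result_Post], goal_cases)
    case (1 t A' L k)
    have "A' \<subseteq> vertices P" using 1(6) S by (auto simp: layered_def)
    then have "(card A')\<^sup>2 \<le> ?n\<^sup>2" using finV by (intro power_mono card_mono) auto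
    then have bound: "(?n\<^sup>2 + 1) * (card L)\<^sup>2 \<le> ?n\<^sup>2"
      by (rule order_trans[OF 1(7)[unfolded mem1]])
    \<comment> \<open>The factor \<open>n^2 + 1\<close> exceeds the square of any possible
      \<open>card A\<close>, so only an empty layer stops the search.\<close>
    have "card L = 0"
    proof (rule ccontr)
      assume "card L \<noteq> 0"
      then have "1 \<le> (card L)\<^sup>2" by (simp add: Suc_le_eq)
      then have "(?n\<^sup>2 + 1) * 1 \<le> (?n\<^sup>2 + 1) * (card L)\<^sup>2" by (rule mult_le_mono2)
      from order_trans[OF this bound] show False by simp
    qed
    moreover have "finite L" using 1(6) finS by (auto simp: layered_def intro: finite_subset)
    ultimately have "L = {}" by simp
    then have A': "A' = A" using 1(6) layered_reach A by metis
    have "k \<le> ?n" using 1(10) card_mono[OF finV S] by (simp add: search_steps_def)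
    then have ops: "num_ops t + 2 \<le> num_ops s + 6 * ?n + 5" using 1(9) by simp
    have t8: "store t 8 = Some (ESet R)" using 1(1) regs by (simp add: same_except_def)
    show ?case
      using 1(2) t8 A'
      apply simp
      apply (rule Q)
      using 1(1) ops by (auto simp: same_except_def)
  qed
qed

lemma runs_extend_step:
  assumes pk: "valid_picker pk" and mdp: "is_mdp P" and inv: "extending P c T s"
    and ne: "T \<noteq> {}"
  shows "runs pk extend_step s (\<lambda>t. \<exists>T'. extending P c T' t \<and> card T' < card T)"
proof -
  let ?n = "card (vertices P)"
  define Q where "Q = (\<lambda>t. \<exists>T'. extending P c T' t \<and> card T' < card T)"
  have finV: "finite (vertices P)" using mdp by (simp add: is_mdp_def)
  have E: "edges P \<subseteq> vertices P \<times> vertices P" using mdp by (simp add: is_mdp_def)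
  have input: "input_regs P (?n\<^sup>2 + 1) s" and s7: "store s 7 = Some (VSet T)"
    and s8: "store s 8 = Some (ESet (ec_rel P (vertices P - T)))" and T: "T \<subseteq> vertices P"
    and cost: "num_ops s + extend_cost ?n * card T \<le> c"
    using inv by (simp_all add: extending_def)
  have finT: "finite T" using T finV by (rule finite_subset)
  have "runs pk extend_step s Q"
    unfolding extend_step_def
  proof (subst runs_simps(7), rule runs_Pick[OF pk _ ne])
    show "store s (aval (Const 7) (mem s)) = Some (VSet T)" using s7 by simp
    fix v assume v: "v \<in> T"
    define U where "U = vertices P - T"
    have insU: "vertices P - (T - {v}) = insert v U" using v T by (auto simp: U_def)
    have va: "vertex_addition P U v"
      by unfold_locales (use mdp v T in \<open>auto simp: U_def\<close>)
    interpret vertex_addition P U v by (fact va)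
    have cU: "card (insert v U) \<le> ?n" using insU finV by (metis Diff_subset card_mono)
    have cT: "card T = card (T - {v}) + 1" using v finT by (metis Suc_eq_plus1 card_Suc_Diff1)
    define s1 where "s1 = (put_set 17 (ESet (edges P - ec_rel P U))
       (put_set 16 (VSet (Domain (ec_rel P U))) (put_set 10 (VSet (insert v U))
       (put_set 7 (VSet (T - {v})) (put_set 9 (VSet {v}) s)))))\<lparr>mem := (mem s)(5 := 0)\<rparr>"
    have s1: "input_regs P (?n\<^sup>2 + 1) s1" "mem s1 5 = 0"
        "store s1 8 = Some (ESet (ec_rel P U))" "store s1 9 = Some (VSet {v})"
        "store s1 10 = Some (VSet (insert v U))" "store s1 16 = Some (VSet (Domain (ec_rel P U)))"
        "store s1 17 = Some (ESet (edges P - ec_rel P U))" "store s1 7 = Some (VSet (T - {v}))"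
        "num_ops s1 = num_ops s + 5"
      using input s8 by (simp_all add: s1_def input_regs_def U_def)
    have "runs pk (While (Eq (var 5) (Const 0)) trim_step) s1 (\<lambda>t. runs pk (set_op 14 Setminus 0 10 ;;
      set_op 14 Pre 1 14 ;; set_op 14 Cap 14 9 ;; set_op 14 Cap 14 3 ;;
      Test (Const 5) Equal (Const 14) (Const 4) ;;
      If (var 5) grow_component Skip ;;
      Test (Const 5) Equal (Const 7) (Const 4)) t Q)"
    proof (rule runs_trim[OF va s1(1-7)], goal_cases)
      case (1 t S)
      have S: "S \<subseteq> insert v U" "v \<in> S" using 1(3) by (simp_all add: trim_inv_def)
      have SV: "S \<subseteq> vertices P" using S(1) insU by auto
      \<comment> \<open>This set is non-empty exactly when \<open>v\<close> is random with an edge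
        out of \<open>S\<close>; its emptiness decides whether \<open>v\<close> is in an
        end-component.\<close>
      define M where "M = (edges P)\<inverse> `` (vertices P - S) \<inter> {v} \<inter> random P"
      have M: "M = {} \<longleftrightarrow> (v \<in> random P \<longrightarrow> edges P `` {v} \<subseteq> S)"
        using E by (auto simp: M_def)
      have t_regs: "store t 0 = Some (VSet (vertices P))" "store t 1 = Some (ESet (edges P))"
          "store t 3 = Some (VSet (random P))" "store t 4 = Some (VSet {})"
          "store t 9 = Some (VSet {v})" "store t 10 = Some (VSet S)"
        using 1(1,2) s1 by (simp_all add: same_except_def input_regs_def)
      define t1 where "t1 = put_answer 5 (of_bool (M = {})) (put_set 14 (VSet M)
         (put_set 14 (VSet ((edges P)\<inverse> `` (vertices P - S) \<inter> {v}))
         (put_set 14 (VSet ((edges P)\<inverse> `` (vertices P - S))) (put_set 14 (VSet (vertices P - S)) t))))"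
      have t1: "same_except {10, 13, 14, 15} {5} s1 t1" "num_ops t1 = num_ops t + 5"
          "store t1 10 = Some (VSet S)" "mem t1 5 = of_bool (M = {})"
        using 1(1) t_regs by (simp_all add: t1_def same_except_def)
      have t1_regs: "input_regs P (?n\<^sup>2 + 1) t1" "store t1 8 = Some (ESet (ec_rel P U))"
          "store t1 9 = Some (VSet {v})"
        using s1 t1(1) input_regs_same_except[OF t1(1)] by (simp_all add: same_except_def)
      \<comment> \<open>The common tail of both branches, with room for the cost of the search even
        in the branch that skips it.\<close>
      have finish: "runs pk (Test (Const 5) Equal (Const 7) (Const 4)) u Q"
        if u: "input_regs P (?n\<^sup>2 + 1) u" "store u 7 = Some (VSet (T - {v}))"
          "store u 8 = Some (ESet (ec_rel P (insert v U)))" "num_ops u \<le> num_ops t1 + 6 * ?n + 5" for u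
      proof -
        have "num_ops u + 1 \<le> num_ops s + extend_cost ?n"
          using u(4) t1(2) 1(5) s1(9) cU by (simp add: extend_cost_def)
        then have "num_ops u + 1 + extend_cost ?n * card (T - {v}) \<le> c"
          using cost unfolding cT by (simp add: algebra_simps)
        then have "extending P c (T - {v}) (put_answer 5 (of_bool (T - {v} = {})) u)"
          using u T by (auto simp: extending_def insU input_regs_def)
        then have "Q (put_answer 5 (of_bool (T - {v} = {})) u)"
          unfolding Q_def using cT by (intro exI[of _ "T - {v}"]) simp
        then show ?thesis
          using u by (simp add: input_regs_def)
      qed
      have "runs pk (If (var 5) grow_component Skip) t1
        (\<lambda>u. runs pk (Test (Const 5) Equal (Const 7) (Const 4)) u Q)"
      proof (cases "M = {}")
        case True
        then have m5: "mem t1 5 = 1" using t1(4) by simp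
        have eq: "ec_rel P (insert v U) = ec_rel P U \<union>
            ((edges P \<inter> S \<times> S)\<^sup>* `` {v}) \<times> ((edges P \<inter> S \<times> S)\<^sup>* `` {v})"
          by (rule ec_rel_insert_reach[OF 1(3,4)]) (use True M in auto)
        have "runs pk grow_component t1 (\<lambda>u. runs pk (Test (Const 5) Equal (Const 7) (Const 4)) u Q)"
        proof (rule runs_grow_component[OF mdp t1_regs t1(3) S(2) SV refl], goal_cases)
          case (1 u)
          show ?case
          proof (rule finish)
            show "input_regs P (?n\<^sup>2 + 1) u"
              using input_regs_same_except[OF 1(1)] t1_regs(1) by simp
            show "store u 7 = Some (VSet (T - {v}))"
              using 1(1) t1(1) s1(8) by (simp add: same_except_def)
          qed (use 1(2,3) eq in simp_all)
        qed
        then show ?thesis using m5 by simp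
      next
        case False
        then have m5: "mem t1 5 = 0" using t1(4) by simp
        obtain u where "v \<in> random P" "(v, u) \<in> edges P" "u \<notin> S" using False M by auto
        then have eq: "ec_rel P (insert v U) = ec_rel P U"
          by (rule ec_rel_insert_random[OF 1(3,4)])
        have "runs pk (Test (Const 5) Equal (Const 7) (Const 4)) t1 Q"
          by (rule finish) (use t1 t1_regs s1(8) eq in \<open>simp_all add: same_except_def\<close>)
        then show ?thesis using m5 by simp
      qed
      then show ?case
        using t_regs M_def[symmetric]
        apply (simp add: setop_result_Pre t1_def del: setop_result.simps(8) One_nat_def runs_simps(4,8))
        apply (subst runs_simps(4))
        apply (simp del: One_nat_def runs_simps(4,8))
        done
    qed
    then show "runs pk (set_op 7 Setminus 7 9 ;; set_op 10 Setminus 0 7 ;;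
        set_op 16 Pre 8 0 ;; set_op 17 Setminus 1 8 ;; Store (Const 5) (Const 0) ;;
        While (Eq (var 5) (Const 0)) trim_step ;;
        set_op 14 Setminus 0 10 ;; set_op 14 Pre 1 14 ;; set_op 14 Cap 14 9 ;; set_op 14 Cap 14 3 ;;
        Test (Const 5) Equal (Const 14) (Const 4) ;;
        If (var 5) grow_component Skip ;;
        Test (Const 5) Equal (Const 7) (Const 4))
        (put_set (aval (Const 9) (mem s)) (VSet {v}) s) Q"
      using s7 s8 input
      by (simp add: s1_def input_regs_def insU U_def[symmetric] setop_result_Pre Pre_vertices_ec_rel
          del: setop_result.simps(8) One_nat_def)
  qed
  then show ?thesis by (simp add: Q_def)
qed

lemma runs_extend:
  assumes pk: "valid_picker pk" and mdp: "is_mdp P"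
    and input: "input_regs P (card (vertices P)) s" and s7: "store s 7 = Some (VSet T)"
    and s8: "store s 8 = Some (ESet (ec_rel P (vertices P - T)))" and T: "T \<subseteq> vertices P"
    and Q: "\<And>t. \<lbrakk>input_regs P ((card (vertices P))\<^sup>2 + 1) t;
      store t 8 = Some (ESet (ec_rel P (vertices P)));
      num_ops t \<le> num_ops s + 1 + extend_cost (card (vertices P)) * card T\<rbrakk> \<Longrightarrow> Q t"
  shows "runs pk extend s Q"
proof -
  let ?n = "card (vertices P)"
  define c where "c = num_ops s + 1 + extend_cost ?n * card T"
  have loop: "runs pk (While (Eq (var 5) (Const 0)) extend_step) t Q" if init: "extending P c T t" for t
  proof (rule runs_While[where I = "extending P c" and f = card, OF init], goal_cases)
    case (1 T t)
    then have "T \<noteq> {}" by (auto simp: extending_def)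
    then show ?case by (rule runs_extend_step[OF pk mdp 1(1)])
  next
    case (2 T t)
    then have "T = {}" by (auto simp: extending_def split: if_splits)
    then show ?case
      using 2 by (intro Q) (auto simp: extending_def c_def)
  qed
  show ?thesis
    unfolding extend_def
    using input s7
    apply (simp add: input_regs_def del: One_nat_def)
    apply (intro conjI impI; rule loop)
    using s8 T
     apply (simp_all add: extending_def input_regs_def power2_eq_square c_def)
    done
qed

section \<open>Third phase: reporting the classes\<close>

definition report_step :: com where
  "report_step =
     Pick (Const 9) (Const 16) ;; set_op 11 Post 8 9 ;; Emit MEC_Block (Const 11) ;;
     set_op 16 Setminus 16 11 ;; Test (Const 5) Equal (Const 16) (Const 4)"

definition report :: com where
  "report =
     set_op 16 Pre 8 0 ;; set_op 10 Setminus 0 16 ;; Test (Const 5) Equal (Const 16) (Const 4) ;;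
     While (Eq (var 5) (Const 0)) report_step ;;
     Test (Const 5) Equal (Const 10) (Const 4) ;; If (var 5) Skip (Emit Rest_Block (Const 10))"

text \<open>The set \<open>W\<close> holds the vertices whose class is still to be reported. A round
  costs 4 operations and uses up a whole class, so charging 4 to each vertex suffices.\<close>

definition reporting :: "'v mdp \<Rightarrow> nat \<Rightarrow> 'v set \<Rightarrow> 'v state \<Rightarrow> bool" where
  "reporting P c W s \<longleftrightarrow> store s 4 = Some (VSet {}) \<and>
     store s 8 = Some (ESet (ec_rel P (vertices P))) \<and> store s 10 = Some (VSet (rest_vertices P)) \<and>
     store s 16 = Some (VSet W) \<and> mem s 5 = of_bool (W = {}) \<and>
     W \<subseteq> Domain (ec_rel P (vertices P)) \<and>
     (\<forall>y z. y \<in> W \<longrightarrow> (y, z) \<in> ec_rel P (vertices P) \<longrightarrow> z \<in> W) \<and>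
     distinct (reported s) \<and>
     set (reported s) =
       (\<lambda>v. (MEC_Block, ec_rel P (vertices P) `` {v})) ` (Domain (ec_rel P (vertices P)) - W) \<and>
     num_ops s + 4 * card W \<le> c"

lemma runs_report_step:
  assumes pk: "valid_picker pk" and mdp: "is_mdp P" and inv: "reporting P c W s" and ne: "W \<noteq> {}"
  shows "runs pk report_step s (\<lambda>t. \<exists>W'. reporting P c W' t \<and> card W' < card W)"
  unfolding report_step_def
proof (subst runs_simps(7), rule runs_Pick[OF pk _ ne])
  let ?R = "ec_rel P (vertices P)"
  have finV: "finite (vertices P)" using mdp by (simp add: is_mdp_def)
  have W: "W \<subseteq> Domain ?R" and sat: "\<And>y z. y \<in> W \<Longrightarrow> (y, z) \<in> ?R \<Longrightarrow> z \<in> W"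
    and s: "store s 4 = Some (VSet {})" "store s 8 = Some (ESet ?R)"
      "store s 10 = Some (VSet (rest_vertices P))" "store s 16 = Some (VSet W)"
      "distinct (reported s)" "num_ops s + 4 * card W \<le> c"
    and set: "set (reported s) = (\<lambda>v. (MEC_Block, ?R `` {v})) ` (Domain ?R - W)"
    using inv unfolding reporting_def by blast+
  show "store s (aval (Const 16) (mem s)) = Some (VSet W)" using s by simp
  fix v assume v: "v \<in> W"
  let ?M = "?R `` {v}"
  obtain z where "(v, z) \<in> ?R" using v W by auto
  then have vM: "v \<in> ?M" by (rule ec_rel_class)
  have MW: "?M \<subseteq> W" using sat v by auto
  have "Domain ?R \<subseteq> vertices P" by (auto dest: ec_rel_subset)
  then have finW: "finite W" using W finV by (meson finite_subset)
  have card: "card (W - ?M) < card W"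
    using vM v finW by (intro psubset_card_mono) auto
  \<comment> \<open>Representatives of reported classes lie outside \<open>W\<close>, whereas the
    class of \<open>v\<close> lies inside it by saturation.\<close>
  have new: "(MEC_Block, ?M) \<notin> set (reported s)"
  proof
    assume "(MEC_Block, ?M) \<in> set (reported s)"
    then obtain u where u: "u \<in> Domain ?R" "u \<notin> W" "?R `` {u} = ?M"
      unfolding set by auto
    then obtain z where "(u, z) \<in> ?R" by auto
    then have "u \<in> ?R `` {u}" by (rule ec_rel_class)
    then show False using u MW by auto
  qed
  have "?R `` {u} = ?M" if "u \<in> ?M" for u
    using that ec_rel_class_eq[of v u P "vertices P"] by simp
  then have "(\<lambda>v. (MEC_Block, ?R `` {v})) ` ?M = (\<lambda>_. (MEC_Block, ?M)) ` ?M"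
    by (intro image_cong) simp_all
  also have "\<dots> = {(MEC_Block, ?M)}"
    using vM by (rule image_constant)
  finally have image_M: "(\<lambda>v. (MEC_Block, ?R `` {v})) ` ?M = {(MEC_Block, ?M)}" .
  have Domain_M: "Domain ?R - (W - ?M) = (Domain ?R - W) \<union> ?M"
    using MW W by blast
  have set': "(\<lambda>v. (MEC_Block, ?R `` {v})) ` (Domain ?R - (W - ?M)) =
      insert (MEC_Block, ?M) (set (reported s))"
    unfolding Domain_M image_Un image_M set by simp
  have sat': "z \<in> W - ?M" if "y \<in> W - ?M" "(y, z) \<in> ?R" for y z
  proof -
    have "z \<in> W" using sat that by blast
    moreover have "z \<notin> ?M" using that ec_rel_trans[OF _ ec_rel_sym[OF that(2)]] by auto
    ultimately show ?thesis by simp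
  qed
  define t where "t = put_answer 5 (of_bool (W - ?M = {})) (put_set 16 (VSet (W - ?M))
    ((put_set 11 (VSet ?M) (put_set 9 (VSet {v}) s))\<lparr>reported := reported s @ [(MEC_Block, ?M)]\<rparr>))"
  have "reporting P c (W - ?M) t"
    unfolding reporting_def
  proof (intro conjI)
    show "\<forall>y z. y \<in> W - ?M \<longrightarrow> (y, z) \<in> ?R \<longrightarrow> z \<in> W - ?M"
      using sat' by blast
    show "set (reported t) = (\<lambda>v. (MEC_Block, ?R `` {v})) ` (Domain ?R - (W - ?M))"
      unfolding set' by (simp add: t_def)
    show "W - ?M \<subseteq> Domain ?R" using W by blast
    show "num_ops t + 4 * card (W - ?M) \<le> c" using s(6) card by (simp add: t_def)
  qed (use s new in \<open>simp_all add: t_def\<close>)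
  then have "\<exists>W'. reporting P c W' t \<and> card W' < card W"
    using card by blast
  then show "runs pk (set_op 11 Post 8 9 ;; Emit MEC_Block (Const 11) ;;
     set_op 16 Setminus 16 11 ;; Test (Const 5) Equal (Const 16) (Const 4))
     (put_set (aval (Const 9) (mem s)) (VSet {v}) s)
     (\<lambda>t. \<exists>W'. reporting P c W' t \<and> card W' < card W)"
    using s by (simp add: t_def setop_result_Post del: setop_result.simps(9))
qed

lemma mec_decomposition_eq:
  "mec_decomposition P =
     (\<lambda>v. (MEC_Block, ec_rel P (vertices P) `` {v})) ` Domain (ec_rel P (vertices P)) \<union>
     (if rest_vertices P = {} then {} else {(Rest_Block, rest_vertices P)})"
  by (auto simp: mec_decomposition_def max_end_component_iff)

lemma runs_report:
  assumes pk: "valid_picker pk" and mdp: "is_mdp P" and input: "input_regs P N s"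
    and s8: "store s 8 = Some (ESet (ec_rel P (vertices P)))"
    and Q: "\<And>t. \<lbrakk>distinct (reported t); set (reported t) = mec_decomposition P;
      num_ops t \<le> num_ops s + 4 * card (vertices P) + 4\<rbrakk> \<Longrightarrow> Q t"
  shows "runs pk report s Q"
proof -
  let ?R = "ec_rel P (vertices P)"
  let ?W = "Domain ?R"
  have finV: "finite (vertices P)" using mdp by (simp add: is_mdp_def)
  have WV: "?W \<subseteq> vertices P" by (auto dest: ec_rel_subset)
  have rest: "vertices P - ?W = rest_vertices P"
    by (simp add: rest_vertices_def Union_max_end_components)
  have sat: "z \<in> ?W" if "(y, z) \<in> ?R" for y z
    by (rule DomainI[OF ec_rel_sym[OF that]])
  \<comment> \<open>Three operations precede the loop; the test after it is the fourth allowed by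
    \<open>Q\<close>.\<close>
  define c where "c = num_ops s + 4 * card (vertices P) + 3"
  have loop: "runs pk (While (Eq (var 5) (Const 0)) report_step) t (\<lambda>t.
      runs pk (Test (Const 5) Equal (Const 10) (Const 4) ;; If (var 5) Skip (Emit Rest_Block (Const 10))) t Q)"
    if init: "reporting P c ?W t" for t
  proof (rule runs_While[where I = "reporting P c" and f = card, OF init], goal_cases)
    case (1 W t)
    then have "W \<noteq> {}" by (auto simp: reporting_def)
    then show ?case by (rule runs_report_step[OF pk mdp 1(1)])
  next
    case (2 W t)
    then have W: "W = {}" by (auto simp: reporting_def split: if_splits)
    have t: "store t 4 = Some (VSet {})" "store t 10 = Some (VSet (rest_vertices P))"
        "distinct (reported t)" "num_ops t \<le> c"
        "set (reported t) = (\<lambda>v. (MEC_Block, ?R `` {v})) ` ?W"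
      using 2 W by (simp_all add: reporting_def)
    show ?case
    proof (cases "rest_vertices P = {}")
      case True
      then show ?thesis
        using t
        apply simp
        apply (rule exI[of _ True], simp)
        apply (rule Q)
        by (auto simp: c_def mec_decomposition_eq)
    next
      case False
      then show ?thesis
        using t
        apply simp
        apply (rule exI[of _ False], simp)
        apply (rule Q)
        by (auto simp: c_def mec_decomposition_eq)
    qed
  qed
  show ?thesis
    unfolding report_def
    using input s8
    apply (simp add: input_regs_def setop_result_Pre Pre_vertices_ec_rel rest
        del: setop_result.simps(8) runs_simps(4,8) One_nat_def)
    apply (subst runs_simps(4))
    apply (simp del: runs_simps(4,8) One_nat_def)
    apply (intro conjI impI; rule loop[unfolded runs_simps(7)])
    using card_mono[OF finV WV]
     apply (auto simp: reporting_def c_def intro: sat)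
    done
qed

section \<open>The complete program\<close>

definition mec_program :: com where
  "mec_program = separate ;; extend ;; report"

text \<open>The constant 12 adds the overheads 7, 1 and 4 of the three phases. The last factor
  bounds the size of the separator.\<close>

definition mec_ops :: "nat \<Rightarrow> real" where
  "mec_ops n = 12 + 4 * real n + refine_cost n * (2 * real n) +
     real (extend_cost n) * (sqrt (real n) * log 2 (real n))"

lemma writes_below_mec_program: "writes_below 18 mec_program"
  by (simp add: mec_program_def separate_def extend_def report_def refine_step_def split_block_def
      replace_block_def forward_search_def backward_search_def finish_block_def search_def
      extend_step_def trim_step_def grow_component_def report_step_def)

lemma computes_mec_decomposition_mec_program:
  assumes mdp: "is_mdp P"
  shows "computes_mec_decomposition mec_program \<epsilon> mec_ops (\<lambda>_. 18) P"
  unfolding computes_mec_decomposition_def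
proof (intro allI impI)
  fix pk :: "'a picker" assume pk: "valid_picker pk"
  let ?n = "card (vertices P)"
  define s where "s = init_state \<epsilon> P"
  have finV: "finite (vertices P)" using mdp by (simp add: is_mdp_def)
  have s: "store s 0 = Some (VSet (vertices P))" "store s 1 = Some (ESet (edges P))"
      "store s 3 = Some (VSet (random P))" "reported s = []" "num_ops s = 0"
    by (simp_all add: s_def init_state_def)
  have "runs pk mec_program s (\<lambda>t. distinct (reported t) \<and> set (reported t) = mec_decomposition P \<and>
      real (num_ops t) \<le> mec_ops ?n)"
    unfolding mec_program_def runs_simps(7)
  proof (rule runs_separate[OF pk mdp s], rule runs_extend[OF pk mdp], assumption, assumption,
      assumption, assumption, rule runs_report[OF pk mdp], assumption, assumption, goal_cases)
    case (1 t T u w)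
    \<comment> \<open>Dividing the entropy bound by the square root of \<open>n\<close> gives this;
      without vertices the separator is empty.\<close>
    have T: "real (card T) \<le> sqrt (real ?n) * log 2 (real ?n)"
    proof (cases "?n = 0")
      case True
      then have "T = {}" using 1(4) finV by auto
      then show ?thesis using True by simp
    next
      case False
      then have "sqrt (real ?n) * real (card T) \<le> sqrt (real ?n) * (sqrt (real ?n) * log 2 (real ?n))"
        using 1(5) by (simp add: entropy_def flip: mult.assoc)
      then show ?thesis using False by simp
    qed
    have "real (num_ops u) \<le> real (num_ops t) + 1 + real (extend_cost ?n) * real (card T)"
      using 1(9) by (simp flip: of_nat_mult of_nat_add of_nat_Suc)
    also have "\<dots> \<le> real (num_ops t) + 1 + real (extend_cost ?n) * (sqrt (real ?n) * log 2 (real ?n))"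
      using T by (intro add_left_mono mult_left_mono) auto
    finally have "real (num_ops w) \<le> mec_ops ?n"
      using 1(6,12) by (simp add: mec_ops_def)
    then show ?case using 1 by simp
  qed
  then obtain t where t: "exec pk mec_program s t" "distinct (reported t)"
      "set (reported t) = mec_decomposition P" "real (num_ops t) \<le> mec_ops ?n"
    by (auto simp: runs_def)
  have "dom (store s) \<subseteq> {..<18}" "peak_space s \<le> 18"
    by (auto simp: s_def init_state_def)
  then have "peak_space t \<le> 18"
    using exec_space[OF t(1) writes_below_mec_program] by blast
  then show "\<exists>t. exec pk mec_program (init_state \<epsilon> P) t \<and> distinct (reported t) \<and>
      set (reported t) = mec_decomposition P \<and> real (num_ops t) \<le> mec_ops ?n \<and>
      real (peak_space t) \<le> 18"
    using t by (auto simp: s_def)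
qed

text \<open>Both phases that dominate have this order: linearly many refinements with a search each,
  and a linear cost for each separator vertex.\<close>

lemma mec_ops_bigo: "mec_ops \<in> O(\<lambda>n. real n powr (3 / 2) * ln (real n))"
  unfolding mec_ops_def refine_cost_def search_bound_def extend_cost_def of_nat_add of_nat_mult
  by real_asymp

theorem theorem2:
  fixes \<epsilon> :: real
  assumes "0 < \<epsilon>" and "\<epsilon> \<le> 1 / 2"
  shows "\<exists>(c :: com) (T :: nat \<Rightarrow> real) (S :: nat \<Rightarrow> real).
           T \<in> O(\<lambda>n. real n powr (2 - \<epsilon>) * ln (real n)) \<and>
           S \<in> O(\<lambda>n. real n powr \<epsilon> * ln (real n)) \<and>
           (\<forall>P :: 'v mdp. is_mdp P \<longrightarrow> computes_mec_decomposition c \<epsilon> T S P)"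
proof (intro exI conjI allI impI)
  show "mec_ops \<in> O(\<lambda>n. real n powr (2 - \<epsilon>) * ln (real n))"
  \<comment> \<open>It remains to compare exponents: \<open>3 / 2 \<le> 2 - \<epsilon>\<close>
    because \<open>\<epsilon> \<le> 1 / 2\<close>.\<close>
  proof (rule landau_o.big_trans[OF mec_ops_bigo], rule landau_o.big.mult_right, rule bigoI)
    show "eventually (\<lambda>n. norm (real n powr (3 / 2)) \<le> 1 * norm (real n powr (2 - \<epsilon>))) at_top"
      using eventually_ge_at_top[of 1] by eventually_elim (use assms in \<open>auto intro: powr_mono\<close>)
  qed
  show "(\<lambda>_. 18) \<in> O(\<lambda>n. real n powr \<epsilon> * ln (real n))"
    using assms(1) by real_asymp
qed (rule computes_mec_decomposition_mec_program)

end
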